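(* Let $A,B,C$ be real $s\times n$ matrices, $d\in\mathbb{R}^s$, and $F(x,v_1)=\{v\in\mathbb{R}^n:Ax+Bv_1-Cv\le d\}$ for $(x,v_1)\in\mathbb{R}^{2n}$. Let $\varphi:\mathbb{R}^{2n}\to\mathbb{R}^1$ be a continuous proper convex function and $Q_0,Q_1\subseteq\mathbb{R}^n$ nonempty convex sets. Consider the primary problem $(PL)$: minimize $\varphi(x(1),x'(1))$ subject to $x''(t)\in F(x(t),x'(t))$ a.e. $t\in[0,1]$, $x(0)\in Q_0$, $x'(0)\in Q_1$; and the dual problem $(PL^* )$: maximize $$-\varphi^*\big(-C^*\lambda'(1)-B^*\lambda(1),\,C^*\lambda(1)\big)+\int_0^1M_F\big(-A^*\lambda(t),-B^*\lambda(t),-C^*\lambda(t)\big)dt-W_{Q_0}\big(C^*\lambda'(0)+B^*\lambda(0)\big)-W_{Q_1}\big(-C^*\lambda(0)\big)$$ over functions $\lambda:[0,1]\to\mathbb{R}^s$ with $\lambda(t)\ge0$ and $C^*\lambda''(t)+B^*\lambda'(t)-A^*\lambda(t)=0$ a.e. A function $x^*(\cdot)$ is called an optimal solution of $(PL^* )$ if $x^*(t)=-C^*\lambda(t)$ for some $\lambda$ attaining the maximum. Let $\tilde x(\cdot)$ be an optimal solution of $(PL)$ for which the sufficient optimality conditions hold, i.e. there exist $x^*,\eta_1^*$ with (i) $\big(x^{*\prime\prime}(t)+\eta_1^{*\prime}(t),\eta_1^*(t)\big)\in F^*\big(x^*(t);(\tilde x(t),\tilde x'(t),\tilde x''(t))\big)$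 a.e. $t\in[0,1]$; (ii) $x^{*\prime}(0)+\eta_1^*(0)\in K_{Q_0}^*(\tilde x(0))$, $-x^*(0)\in K_{Q_1}^*(\tilde x'(0))$; (iii) $\big(x^{*\prime}(1)+\eta_1^*(1),-x^*(1)\big)\in\partial\varphi(\tilde x(1),\tilde x'(1))$; (iv) $\tilde x''(t)\in F_A(\tilde x(t),\tilde x'(t);x^*(t))$ a.e. $t\in[0,1]$. Then $\tilde x^*(t)$, $t\in[0,1]$, is an optimal solution of $(PL^* )$ if and only if there is a function $\lambda(t)\ge0$, $t\in[0,1]$, with $\tilde x^*=-C^*\lambda$, such that (1) $C^*\lambda''(t)+B^*\lambda'(t)-A^*\lambda(t)=0$ and $\langle A\tilde x(t)+B\tilde x'(t)-C\tilde x''(t)-d,\lambda(t)\rangle=0$ a.e. $t\in[0,1]$; (2) $-C^*\lambda'(0)-B^*\lambda(0)\in K^*_{Q_0}(\tilde x(0))$ and $C^*\lambda(0)\in K^*_{Q_1}(\tilde x'(0))$; (3) $\big(-C^*\lambda'(1)-B^*\lambda(1),\,C^*\lambda(1)\big)\in\partial\varphi(\tilde x(1),\tilde x'(1))$. In addition, the optimal values of $(PL)$ and $(PL^* )$ are equal.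
   Context: Feasible trajectories of $(PL)$ are functions $x:[0,1]\to\mathbb{R}^n$ with $x,x'$ absolutely continuous and $x''\in L_1^n([0,1])$ satisfying the constraints. In (i)–(iv), $x^*:[0,1]\to\mathbb{R}^n$ is absolutely continuous together with its first derivative, with $x^{*\prime\prime}\in L_1^n([0,1])$, and $\eta_1^*:[0,1]\to\mathbb{R}^n$ is absolutely continuous with derivative in $L_1^n([0,1])$. Functions $\lambda$ are such that $x^*:=-C^*\lambda$ and $\eta_1^*:=-B^*\lambda$ have this same regularity; $C^*\lambda'$, $C^*\lambda''$, $B^*\lambda'$ denote $(C^*\lambda)'$, $(C^*\lambda)''$, $(B^*\lambda)'$. Vector inequalities are componentwise; $A^*,B^*,C^*$ are transposes. For a convex set $S$ and $z\in S$, $K_S(z)=\{\mu(y-z):y\in S,\mu>0\}$ and $K_S^*(z)=\{z^*:\langle\bar z,z^*\rangle\ge0\ \forall\bar z\in K_S(z)\}$. With $\operatorname{gph}F=\{(x,v_1,v):v\in F(x,v_1)\}$, the locally adjoint mapping at $z\in\operatorname{gph}F$ is $F^*(v^*;z)=\{(x^*,v_1^* ):(x^*,v_1^*,-v^* )\in K^*_{\operatorname{gph}F}(z)\}$; the argmaximum set is $F_A(x,v_1;v^* )=\{v\in F(x,v_1):\langle v,v^*\rangle=\sup_{w\in F(x,v_1)}\langle w,v^*\rangle\}$; and $M_F(x^*,v_1^*,v^* )=\inf\{\langle x,x^*\rangle+\langle v_1,v_1^*\rangle-\langle v,v^*\rangle:(x,v_1,v)\in\operatorname{gph}F\}$. $W_Q(y^*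 )=\sup_{y\in Q}\langle y,y^*\rangle$ is the support function, $\varphi^*$ the convex conjugate and $\partial\varphi$ the convex subdifferential of $\varphi$. *)

theory Defs
  imports "HOL-Analysis.Analysis"
begin

section \<open>Convex analysis\<close>

definition tangent_cone :: "'a::real_inner set \<Rightarrow> 'a \<Rightarrow> 'a set" where
  "tangent_cone S z = {\<mu> *\<^sub>R (y - z) | y \<mu>. y \<in> S \<and> \<mu> > 0}"

definition dual_tangent_cone :: "'a::real_inner set \<Rightarrow> 'a \<Rightarrow> 'a set" where
  "dual_tangent_cone S z = {w. \<forall>u \<in> tangent_cone S z. u \<bullet> w \<ge> 0}"

definition gph :: "('a \<Rightarrow> 'a \<Rightarrow> 'a set) \<Rightarrow> ('a \<times> 'a \<times> 'a) set" where
  "gph F = {(x, v1, v). v \<in> F x v1}"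

definition locally_adjoint ::
  "('a::real_inner \<Rightarrow> 'a \<Rightarrow> 'a set) \<Rightarrow> 'a \<Rightarrow> 'a \<times> 'a \<times> 'a \<Rightarrow> ('a \<times> 'a) set" where
  "locally_adjoint F vs z = {(xs, v1s). (xs, v1s, - vs) \<in> dual_tangent_cone (gph F) z}"

definition argmax_set :: "('a::real_inner \<Rightarrow> 'a \<Rightarrow> 'a set) \<Rightarrow> 'a \<Rightarrow> 'a \<Rightarrow> 'a \<Rightarrow> 'a set" where
  "argmax_set F x v1 vs =
     {v \<in> F x v1. ereal (v \<bullet> vs) = (SUP w \<in> F x v1. ereal (w \<bullet> vs))}"

definition M_fun :: "('a::real_inner \<Rightarrow> 'a \<Rightarrow> 'a set) \<Rightarrow> 'a \<Rightarrow> 'a \<Rightarrow> 'a \<Rightarrow> ereal" where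
  "M_fun F xs v1s vs = (INF (x, v1, v) \<in> gph F. ereal (x \<bullet> xs + v1 \<bullet> v1s - v \<bullet> vs))"

definition support_fun :: "'a::real_inner set \<Rightarrow> 'a \<Rightarrow> ereal" where
  "support_fun Q p = (SUP y \<in> Q. ereal (y \<bullet> p))"

text \<open>A function with values in type \<^typ>\<open>real\<close> on the whole space is automatically proper;
  its conjugate may take the value \<open>\<infinity>\<close>.\<close>

definition conjugate :: "('a::real_inner \<Rightarrow> real) \<Rightarrow> 'a \<Rightarrow> ereal" where
  "conjugate f p = (SUP z. ereal (z \<bullet> p - f z))"

definition subdifferential :: "('a::real_inner \<Rightarrow> real) \<Rightarrow> 'a \<Rightarrow> 'a set" where
  "subdifferential f z = {p. \<forall>y. f y - f z \<ge> (y - z) \<bullet> p}"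


section \<open>Absolutely continuous functions on the unit interval\<close>

text \<open>The usual epsilon-delta condition. The members of a division are finitely many nondegenerate
  or one-point closed intervals with pairwise disjoint interiors; \<open>Inf K\<close> and \<open>Sup K\<close> are the
  end points of such an interval \<open>K\<close>.\<close>

definition abs_continuous_on :: "real set \<Rightarrow> (real \<Rightarrow> 'a::real_normed_vector) \<Rightarrow> bool" where
  "abs_continuous_on S f \<longleftrightarrow>
     (\<forall>\<epsilon>>0. \<exists>\<delta>>0. \<forall>D T. D division_of T \<and> T \<subseteq> S \<and> (\<Sum>K\<in>D. measure lborel K) < \<delta>
        \<longrightarrow> (\<Sum>K\<in>D. norm (f (Sup K) - f (Inf K))) < \<epsilon>)"

text \<open>The derivative on the unit interval, one-sided at the end points. At a point where it does not
  exist it has an unspecified value.\<close>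

definition D01 :: "(real \<Rightarrow> 'a::real_normed_vector) \<Rightarrow> real \<Rightarrow> 'a" where
  "D01 f t = vector_derivative f (at t within {0..1})"

definition AC1 :: "(real \<Rightarrow> 'a::euclidean_space) \<Rightarrow> bool" where
  "AC1 f \<longleftrightarrow> abs_continuous_on {0..1} f
     \<and> (AE t in lebesgue_on {0..1}. f differentiable (at t within {0..1}))
     \<and> D01 f absolutely_integrable_on {0..1}"

definition AC2 :: "(real \<Rightarrow> 'a::euclidean_space) \<Rightarrow> bool" where
  "AC2 f \<longleftrightarrow> abs_continuous_on {0..1} f
     \<and> (\<forall>t\<in>{0..1}. f differentiable (at t within {0..1}))
     \<and> AC1 (D01 f)"


section \<open>The primary problem\<close>

definition poly_map ::
  "real^'n^'s \<Rightarrow> real^'n^'s \<Rightarrow> real^'n^'s \<Rightarrow> real^'s \<Rightarrow> real^'n \<Rightarrow> real^'n \<Rightarrow> (real^'n) set" where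
  "poly_map A B C d x v1 = {v. A *v x + B *v v1 - C *v v \<le> d}"

definition primal_feasible ::
  "('a::euclidean_space \<Rightarrow> 'a \<Rightarrow> 'a set) \<Rightarrow> 'a set \<Rightarrow> 'a set \<Rightarrow> (real \<Rightarrow> 'a) \<Rightarrow> bool" where
  "primal_feasible F Q0 Q1 x \<longleftrightarrow> AC2 x
     \<and> (AE t in lebesgue_on {0..1}. D01 (D01 x) t \<in> F (x t) (D01 x t))
     \<and> x 0 \<in> Q0 \<and> D01 x 0 \<in> Q1"

definition primal_optimal ::
  "('a::euclidean_space \<Rightarrow> 'a \<Rightarrow> 'a set) \<Rightarrow> ('a \<times> 'a \<Rightarrow> real) \<Rightarrow> 'a set \<Rightarrow> 'a set \<Rightarrow> (real \<Rightarrow> 'a) \<Rightarrow> bool"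
  where
  "primal_optimal F \<phi> Q0 Q1 x \<longleftrightarrow> primal_feasible F Q0 Q1 x
     \<and> (\<forall>y. primal_feasible F Q0 Q1 y \<longrightarrow> \<phi> (x 1, D01 x 1) \<le> \<phi> (y 1, D01 y 1))"

definition primal_value ::
  "('a::euclidean_space \<Rightarrow> 'a \<Rightarrow> 'a set) \<Rightarrow> ('a \<times> 'a \<Rightarrow> real) \<Rightarrow> 'a set \<Rightarrow> 'a set \<Rightarrow> ereal" where
  "primal_value F \<phi> Q0 Q1 = (INF x \<in> {x. primal_feasible F Q0 Q1 x}. ereal (\<phi> (x 1, D01 x 1)))"


section \<open>The dual problem\<close>

text \<open>The Lebesgue integral of an extended real function as the difference of the integrals of its
  positive and negative parts; \<^const>\<open>e2ennreal\<close> maps negative numbers to \<open>0\<close>. The integrand of the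
  dual problem may have integral \<open>-\<infinity>\<close>, but if the primary problem has a feasible trajectory its
  positive part has a finite integral, so that the case \<open>\<infinity> - \<infinity>\<close> does not arise, neither here nor
  in \<open>dual_objective\<close>.\<close>

definition ereal_integral :: "'a measure \<Rightarrow> ('a \<Rightarrow> ereal) \<Rightarrow> ereal" where
  "ereal_integral M f =
     enn2ereal (\<integral>\<^sup>+ t. e2ennreal (f t) \<partial>M) - enn2ereal (\<integral>\<^sup>+ t. e2ennreal (- f t) \<partial>M)"

definition tmul :: "real^'n^'s \<Rightarrow> (real \<Rightarrow> real^'s) \<Rightarrow> real \<Rightarrow> real^'n" where
  "tmul C l = (\<lambda>t. transpose C *v l t)"

text \<open>No regularity of the multiplier itself is required: \<open>C\<^sup>*\<lambda>'\<close>, \<open>C\<^sup>*\<lambda>''\<close> and \<open>B\<^sup>*\<lambda>'\<close> are the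
  derivatives of the products \<open>C\<^sup>*\<lambda>\<close> and \<open>B\<^sup>*\<lambda>\<close>.\<close>

definition regular_multiplier ::
  "real^'n^'s \<Rightarrow> real^'n^'s \<Rightarrow> (real \<Rightarrow> real^'s) \<Rightarrow> bool" where
  "regular_multiplier B C l \<longleftrightarrow> AC2 (\<lambda>t. - tmul C l t) \<and> AC1 (\<lambda>t. - tmul B l t)"

definition dual_feasible ::
  "real^'n^'s \<Rightarrow> real^'n^'s \<Rightarrow> real^'n^'s \<Rightarrow> (real \<Rightarrow> real^'s) \<Rightarrow> bool" where
  "dual_feasible A B C l \<longleftrightarrow> regular_multiplier B C l
     \<and> (\<forall>t\<in>{0..1}. 0 \<le> l t)
     \<and> (AE t in lebesgue_on {0..1}. D01 (D01 (tmul C l)) t + D01 (tmul B l) t - tmul A l t = 0)"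

definition dual_objective ::
  "real^'n^'s \<Rightarrow> real^'n^'s \<Rightarrow> real^'n^'s \<Rightarrow> real^'s \<Rightarrow> ((real^'n) \<times> (real^'n) \<Rightarrow> real)
     \<Rightarrow> (real^'n) set \<Rightarrow> (real^'n) set \<Rightarrow> (real \<Rightarrow> real^'s) \<Rightarrow> ereal" where
  "dual_objective A B C d \<phi> Q0 Q1 l =
     - conjugate \<phi> (- D01 (tmul C l) 1 - tmul B l 1, tmul C l 1)
     + ereal_integral (lebesgue_on {0..1})
         (\<lambda>t. M_fun (poly_map A B C d) (- tmul A l t) (- tmul B l t) (- tmul C l t))
     - support_fun Q0 (D01 (tmul C l) 0 + tmul B l 0)
     - support_fun Q1 (- tmul C l 0)"

definition dual_optimal ::
  "real^'n^'s \<Rightarrow> real^'n^'s \<Rightarrow> real^'n^'s \<Rightarrow> real^'s \<Rightarrow> ((real^'n) \<times> (real^'n) \<Rightarrow> real)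
     \<Rightarrow> (real^'n) set \<Rightarrow> (real^'n) set \<Rightarrow> (real \<Rightarrow> real^'n) \<Rightarrow> bool" where
  "dual_optimal A B C d \<phi> Q0 Q1 xs \<longleftrightarrow>
     (\<exists>l. dual_feasible A B C l
        \<and> (\<forall>m. dual_feasible A B C m
              \<longrightarrow> dual_objective A B C d \<phi> Q0 Q1 m \<le> dual_objective A B C d \<phi> Q0 Q1 l)
        \<and> (\<forall>t\<in>{0..1}. xs t = - tmul C l t))"

definition dual_value ::
  "real^'n^'s \<Rightarrow> real^'n^'s \<Rightarrow> real^'n^'s \<Rightarrow> real^'s \<Rightarrow> ((real^'n) \<times> (real^'n) \<Rightarrow> real)
     \<Rightarrow> (real^'n) set \<Rightarrow> (real^'n) set \<Rightarrow> ereal" where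
  "dual_value A B C d \<phi> Q0 Q1 =
     (SUP l \<in> {l. dual_feasible A B C l}. dual_objective A B C d \<phi> Q0 Q1 l)"

end

theory Submission
  imports Defs
begin

text \<open>
  Everything rests on one inequality whose equality case is understood completely. Let \<open>x\<close> be a
  feasible trajectory of the primary problem, \<open>\<lambda>\<close> a feasible multiplier of the dual one, and
  \<open>p = C\<^sup>*\<lambda>\<close>, \<open>q = B\<^sup>*\<lambda>\<close>. Each term of the dual objective is an extremum over a set that contains the
  data of \<open>x\<close>, and testing it with these data gives an estimate: Fenchel's inequality for \<open>\<phi>\<^sup>*\<close> at
  \<open>(x(1), x'(1))\<close>, the definition of \<open>W\<close> at \<open>x(0)\<close> and \<open>x'(0)\<close>, and, for almost every \<open>t\<close>, the bound
  \<open>M\<^sub>F \<le> g(t)\<close> obtained from \<open>(x, x', x'')\<close>, where the adjoint equation \<open>p'' + q' = A\<^sup>*\<lambda>\<close> turns the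
  bound into \<open>g = \<langle>x'', p\<rangle> - \<langle>x, p'' + q'\<rangle> - \<langle>x', q\<rangle>\<close>. This \<open>g\<close> is the derivative of
  \<open>\<langle>x', p\<rangle> - \<langle>x, p' + q\<rangle>\<close>, so its integral consists of boundary terms, and these cancel all other terms
  except \<open>\<phi>(x(1), x'(1))\<close>. Hence the dual objective is at most \<open>\<phi>(x(1), x'(1))\<close>, with equality iff
  every single estimate is an equality (\<open>duality_gap\<close>). The equality cases are a subgradient
  condition, two conditions on dual tangent cones, and membership in the locally adjoint mapping
  for almost every \<open>t\<close>.

  For the polyhedral \<open>F\<close> a Farkas type description of the normal cones of a polyhedron
  (\<open>polyhedron_normal_cone_multipliers\<close>) says that the last membership holds iff some nonnegative
  vector, with the same images under \<open>A\<^sup>*\<close>, \<open>B\<^sup>*\<close>, \<open>C\<^sup>*\<close> as \<open>\<lambda>(t)\<close>, satisfies complementary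
  slackness. That vector may differ from \<open>\<lambda>(t)\<close>; but feasibility and objective of the dual problem
  see the multiplier only through these images and its sign, so it may be exchanged pointwise,
  without any measurable selection (\<open>exists_complementary_multiplier\<close>). So the
  value \<open>\<phi>(x(1), x'(1))\<close> is attained by \<open>\<lambda>\<close> iff a multiplier with the same three products
  satisfies complementary slackness and the conditions at both end points.

  It remains to see that this value is attained. The same description turns the adjoint inclusion for \<open>x\<^sup>*\<close> into
  a nonnegative multiplier at almost every \<open>t\<close>; the exceptional \<open>t\<close> are reached because \<open>x\<^sup>*\<close> and
  \<open>\<eta>\<^sub>1\<^sup>*\<close> are continuous and finitely generated cones are closed (\<open>exists_adjoint_multiplier\<close>).
\<close>

section \<open>Normal cones of polyhedra\<close>

text \<open>
  The positive factors in the tangent cone do not affect the sign of the inner product.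
\<close>

lemma dual_tangent_cone_iff:
  "w \<in> dual_tangent_cone S z \<longleftrightarrow> (\<forall>y\<in>S. (y - z) \<bullet> w \<ge> 0)"
proof -
  have "(y - z) \<bullet> w \<ge> 0" if "\<forall>u\<in>tangent_cone S z. u \<bullet> w \<ge> 0" "y \<in> S" for y
  proof -
    have "1 *\<^sub>R (y - z) \<in> tangent_cone S z"
      unfolding tangent_cone_def using that(2) zero_less_one by blast
    with that(1) show ?thesis by fastforce
  qed
  then show ?thesis
    by (auto simp: dual_tangent_cone_def tangent_cone_def)
qed

lemma convex_cone_hull_sum:
  assumes "finite I" "\<And>i. i \<in> I \<Longrightarrow> f i \<in> convex_cone hull S"
  shows "sum f I \<in> convex_cone hull S"
  using assms by (induction I rule: finite_induct) (auto simp: convex_cone_hull_contains_0 convex_cone_hull_add)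

text \<open>
  The coordinates of a vector are the coefficients of a nonnegative combination of unit vectors. The
  face is thereby finitely generated, which makes its linear images closed; for images of general
  closed cones this fails.
\<close>

lemma orthant_face_eq_convex_cone_hull:
  "{l::real^'s. 0 \<le> l \<and> (\<forall>i. i \<notin> I \<longrightarrow> l $ i = 0)} = convex_cone hull ((\<lambda>i. axis i 1) ` I)"
    (is "?L = ?H")
proof (rule antisym)
  show "?L \<subseteq> ?H"
  proof
    fix l assume l: "l \<in> ?L"
    have "l = (\<Sum>i\<in>I. l $ i *\<^sub>R axis i 1)"
      using l by (auto simp: vec_eq_iff axis_def if_distrib cong: if_cong)
    also have "\<dots> \<in> ?H"
      using l by (intro convex_cone_hull_sum convex_cone_hull_mul hull_inc) (auto simp: less_eq_vec_def)
    finally show "l \<in> ?H" .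
  qed
next
  have L: "convex_cone ?L"
    by (auto simp: convex_cone_iff less_eq_vec_def)
  have "axis i 1 \<in> ?L" if "i \<in> I" for i using that by (auto simp: axis_def less_eq_vec_def)
  with L show "?H \<subseteq> ?L" by (intro hull_minimal) auto
qed

lemma closed_linear_image_orthant_face:
  fixes h :: "real^'s \<Rightarrow> 'a::euclidean_space"
  assumes "linear h"
  shows "closed (h ` {l. 0 \<le> l \<and> (\<forall>i. i \<notin> I \<longrightarrow> l $ i = 0)})"
  unfolding orthant_face_eq_convex_cone_hull convex_cone_hull_linear_image[OF assms, symmetric]
  by (intro closed_convex_cone_hull) auto

text \<open>
  The bipolar theorem for closed convex cones: a hyperplane that strictly separates \<open>w\<close> from \<open>K\<close> can
  be moved to the origin, since a negative value on \<open>K\<close> would become arbitrarily negative by scaling.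
\<close>

lemma mem_closed_convex_cone_if_nonneg:
  fixes K :: "'a::euclidean_space set"
  assumes K: "convex_cone K" "closed K"
    and nonneg: "\<And>u. (\<And>k. k \<in> K \<Longrightarrow> u \<bullet> k \<ge> 0) \<Longrightarrow> u \<bullet> w \<ge> 0"
  shows "w \<in> K"
proof (rule ccontr)
  assume "w \<notin> K"
  have "convex K" using K(1) by (simp add: convex_cone_def)
  then obtain u b where u: "u \<bullet> w < b" and b: "\<And>k. k \<in> K \<Longrightarrow> u \<bullet> k > b"
    using separating_hyperplane_closed_point[OF _ K(2) \<open>w \<notin> K\<close>] by blast
  have "b < 0" using b[of 0] K(1) by (simp add: convex_cone_contains_0)
  have "u \<bullet> k \<ge> 0" if k: "k \<in> K" for k
  proof (rule ccontr)
    assume "\<not> u \<bullet> k \<ge> 0"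
    then have neg: "u \<bullet> k < 0" by simp
    \<comment> \<open>the multiple of \<open>k\<close> on which \<open>u\<close> takes the value \<open>b\<close>\<close>
    then have "(b / (u \<bullet> k)) *\<^sub>R k \<in> K"
      using K(1) k \<open>b < 0\<close> by (simp add: convex_cone_iff divide_nonpos_neg)
    from b[OF this] neg show False by simp
  qed
  from nonneg[OF this] u \<open>b < 0\<close> show False by linarith
qed

text \<open>
  Farkas' lemma in the form of multipliers. Only the constraints active at \<open>z\<close> matter: a direction
  that does not increase any of them stays feasible for a small step, because the inactive
  constraints have some slack. So \<open>w\<close> is nonnegative on the polar of the cone generated by the
  negatives of the active rows, and that cone is closed. Multipliers supported on active constraints
  are the complementary ones.
\<close>

theorem polyhedron_normal_cone_multipliers:
  fixes h :: "'a::euclidean_space \<Rightarrow> real^'s"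
  assumes h: "linear h" and z: "h z \<le> d"
  shows "(\<forall>y. h y \<le> d \<longrightarrow> (y - z) \<bullet> w \<ge> 0)
    \<longleftrightarrow> (\<exists>l. 0 \<le> l \<and> w = - adjoint h l \<and> (h z - d) \<bullet> l = 0)" (is "?lhs \<longleftrightarrow> ?rhs")
proof
  assume ?rhs
  then obtain l where l: "0 \<le> l" "w = - adjoint h l" "(h z - d) \<bullet> l = 0" by blast
  show ?lhs
  proof (intro allI impI)
    fix y assume y: "h y \<le> d"
    have "(d - h y) \<bullet> l \<ge> 0"
      using y l(1) by (auto simp: inner_vec_def less_eq_vec_def intro!: sum_nonneg)
    moreover have "(y - z) \<bullet> w = - (h y - h z) \<bullet> l"
      using adjoint_works[OF h, of "y - z" l] h by (simp add: l(2) linear_diff inner_diff_left)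
    ultimately show "(y - z) \<bullet> w \<ge> 0"
      using l(3) by (simp add: inner_diff_left)
  qed
next
  assume lhs: ?lhs
  define I where "I = {i. h z $ i = d $ i}"
  define L where "L = {l::real^'s. 0 \<le> l \<and> (\<forall>i. i \<notin> I \<longrightarrow> l $ i = 0)}"
  define g where "g l = - adjoint h l" for l
  have g: "linear g" unfolding g_def using adjoint_linear[OF h] by (rule linear_compose_neg)
  have "w \<in> g ` L"
  proof (rule mem_closed_convex_cone_if_nonneg)
    show "convex_cone (g ` L)"
      unfolding L_def orthant_face_eq_convex_cone_hull using g convex_cone_convex_cone_hull by (blast intro: convex_cone_linear_image)
    show "closed (g ` L)" unfolding L_def by (rule closed_linear_image_orthant_face[OF g])
    fix u assume u: "\<And>k. k \<in> g ` L \<Longrightarrow> u \<bullet> k \<ge> 0"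
    have active: "h u $ i \<le> 0" if "i \<in> I" for i
    proof -
      have "axis i 1 \<in> L" using that by (auto simp: L_def axis_def less_eq_vec_def)
      then have "u \<bullet> g (axis i 1) \<ge> 0" using u by blast
      then show ?thesis
        by (simp add: g_def adjoint_works[OF h] inner_axis)
    qed
    have "\<exists>\<epsilon>>0. \<epsilon> * h u $ i \<le> d $ i - h z $ i" for i
    proof (cases "i \<in> I")
      case True
      then show ?thesis using active[OF True] by (intro exI[of _ 1]) (auto simp: I_def)
    next
      case False
      define s where "s = d $ i - h z $ i"
      have "s > 0" using False z by (auto simp: I_def s_def less_eq_vec_def order_less_le)
      \<comment> \<open>the added \<open>1\<close> avoids a case distinction on \<open>h u $ i = 0\<close>\<close>
      have "s / (\<bar>h u $ i\<bar> + 1) * h u $ i \<le> s"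
        using \<open>s > 0\<close> by (subst times_divide_eq_left, subst pos_divide_le_eq) auto
      then show ?thesis using \<open>s > 0\<close>
        by (intro exI[of _ "s / (\<bar>h u $ i\<bar> + 1)"]) (auto simp: s_def add_nonneg_pos)
    qed
    then obtain e where e: "\<And>i. e i > 0" "\<And>i. e i * h u $ i \<le> d $ i - h z $ i" by metis
    define \<epsilon> where "\<epsilon> = Min (range e)"
    have "\<epsilon> > 0" using e(1) by (simp add: \<epsilon>_def)
    have "\<epsilon> * h u $ i \<le> d $ i - h z $ i" for i
    proof (cases "h u $ i \<ge> 0")
      case True
      have "\<epsilon> \<le> e i" by (simp add: \<epsilon>_def)
      then show ?thesis using e(2)[of i] True mult_right_mono by fastforce
    next
      case False
      then have "\<epsilon> * h u $ i \<le> 0" using \<open>\<epsilon> > 0\<close> by (simp add: mult_nonneg_nonpos)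
      moreover have "d $ i - h z $ i \<ge> 0" using z by (simp add: less_eq_vec_def)
      ultimately show ?thesis by linarith
    qed
    then have "h (z + \<epsilon> *\<^sub>R u) \<le> d"
      using h by (simp add: linear_add linear_scale less_eq_vec_def algebra_simps)
    with lhs have "(\<epsilon> *\<^sub>R u) \<bullet> w \<ge> 0" by fastforce
    then show "u \<bullet> w \<ge> 0" using \<open>\<epsilon> > 0\<close> by (simp add: zero_le_mult_iff)
  qed
  then obtain l where l: "l \<in> L" "w = g l" by blast
  have "(h z - d) \<bullet> l = 0"
    using l(1) by (auto simp: L_def I_def inner_vec_def intro!: sum.neutral)
  then show ?rhs using l by (auto simp: L_def g_def)
qed

lemma locally_adjoint_poly_map_iff:
  assumes z: "v \<in> poly_map A B C d x v1"
  shows "(a, b) \<in> locally_adjoint (poly_map A B C d) w (x, v1, v) \<longleftrightarrow>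
    (\<exists>l. 0 \<le> l \<and> a = - (transpose A *v l) \<and> b = - (transpose B *v l) \<and> w = - (transpose C *v l)
       \<and> (A *v x + B *v v1 - C *v v - d) \<bullet> l = 0)"
proof -
  define h where "h = (\<lambda>(x, v1, v). A *v x + B *v v1 - C *v v)"
  have h: "linear h"
    by (rule linearI) (auto simp: h_def matrix_vector_right_distrib scaleR_matrix_vector_assoc
        matrix_scaleR_vector_ac algebra_simps matrix_vector_mult_diff_distrib)
  have adj: "adjoint h = (\<lambda>l. (transpose A *v l, transpose B *v l, - (transpose C *v l)))"
    by (rule adjoint_unique) (auto simp: h_def inner_add_left inner_diff_left dot_lmul_matrix
        simp flip: vector_transpose_matrix)
  have "gph (poly_map A B C d) = {y. h y \<le> d}" by (auto simp: gph_def poly_map_def h_def)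
  then have "(a, b) \<in> locally_adjoint (poly_map A B C d) w (x, v1, v)
      \<longleftrightarrow> (\<forall>y. h y \<le> d \<longrightarrow> (y - (x, v1, v)) \<bullet> (a, b, - w) \<ge> 0)"
    by (auto simp: locally_adjoint_def dual_tangent_cone_iff)
  also have "\<dots> \<longleftrightarrow> (\<exists>l. 0 \<le> l \<and> (a, b, - w) = - adjoint h l \<and> (h (x, v1, v) - d) \<bullet> l = 0)"
    using z by (intro polyhedron_normal_cone_multipliers[OF h]) (simp add: h_def poly_map_def)
  also have "\<dots> \<longleftrightarrow> (\<exists>l. 0 \<le> l \<and> a = - (transpose A *v l) \<and> b = - (transpose B *v l) \<and> w = - (transpose C *v l)
       \<and> (A *v x + B *v v1 - C *v v - d) \<bullet> l = 0)"
  proof -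
    have "- w = c \<longleftrightarrow> w = - c" for c by (metis minus_minus)
    then show ?thesis unfolding adj by (intro ex_cong1) (simp add: h_def)
  qed
  finally show ?thesis .
qed

section \<open>Integrals of extended real functions\<close>

lemma ereal_integral_real:
  assumes "integrable M g"
  shows "ereal_integral M (\<lambda>t. ereal (g t)) = ereal (integral\<^sup>L M g)"
proof -
  have "(\<integral>\<^sup>+t. ennreal (g t) \<partial>M) \<noteq> \<infinity>" "(\<integral>\<^sup>+t. ennreal (- g t) \<partial>M) \<noteq> \<infinity>"
    using assms by (simp_all add: real_integrable_def)
  then show ?thesis
    unfolding ereal_integral_def real_lebesgue_integral_def[OF assms]
    by (cases "\<integral>\<^sup>+t. ennreal (g t) \<partial>M"; cases "\<integral>\<^sup>+t. ennreal (- g t) \<partial>M")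
       (auto simp: ennreal.rep_eq e2ennreal_ereal)
qed

lemma ereal_integral_mono_AE:
  assumes "AE t in M. f t \<le> g t"
  shows "ereal_integral M f \<le> ereal_integral M g"
  unfolding ereal_integral_def
proof (rule ereal_minus_mono)
  show "enn2ereal (\<integral>\<^sup>+t. e2ennreal (f t) \<partial>M) \<le> enn2ereal (\<integral>\<^sup>+t. e2ennreal (g t) \<partial>M)"
    unfolding less_eq_ennreal.rep_eq[symmetric]
    using assms by (intro nn_integral_mono_AE) (auto intro: e2ennreal_mono)
  show "enn2ereal (\<integral>\<^sup>+t. e2ennreal (- g t) \<partial>M) \<le> enn2ereal (\<integral>\<^sup>+t. e2ennreal (- f t) \<partial>M)"
    unfolding less_eq_ennreal.rep_eq[symmetric]
    using assms by (intro nn_integral_mono_AE, elim eventually_mono) (auto intro!: e2ennreal_mono)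
qed

lemma ereal_integral_cong_AE:
  assumes "AE t in M. f t = g t"
  shows "ereal_integral M f = ereal_integral M g"
  using assms by (intro antisym ereal_integral_mono_AE) auto

text \<open>
  Equality of the integrals forces both parts of \<open>f\<close> to have finite integrals, so \<open>f\<close> is a real
  integrable function almost everywhere, and a nonnegative \<open>g - f\<close> with integral zero vanishes almost
  everywhere. Measurability of \<open>f\<close> is essential: for other functions the two integrals that define
  \<^const>\<open>ereal_integral\<close> are only lower integrals.
\<close>

lemma AE_eq_if_ereal_integral_eq:
  assumes f: "f \<in> borel_measurable M" and g: "integrable M g"
    and le: "AE t in M. f t \<le> ereal (g t)"
    and eq: "ereal_integral M f = ereal (integral\<^sup>L M g)"
  shows "AE t in M. f t = ereal (g t)"
proof -
  note [measurable] = f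
  have "(\<integral>\<^sup>+t. e2ennreal (f t) \<partial>M) \<le> (\<integral>\<^sup>+t. ennreal (g t) \<partial>M)"
    using le by (intro nn_integral_mono_AE) (auto simp flip: e2ennreal_ereal intro: e2ennreal_mono)
  also have "\<dots> < \<infinity>" using g by (simp add: real_integrable_def less_top)
  finally have pos: "(\<integral>\<^sup>+t. e2ennreal (f t) \<partial>M) < \<infinity>" .
  then have neg: "(\<integral>\<^sup>+t. e2ennreal (- f t) \<partial>M) < \<infinity>"
    using eq unfolding ereal_integral_def
    by (cases "\<integral>\<^sup>+t. e2ennreal (- f t) \<partial>M"; cases "\<integral>\<^sup>+t. e2ennreal (f t) \<partial>M") (auto simp: ennreal.rep_eq)
  define r where "r t = real_of_ereal (f t)" for t
  have "AE t in M. e2ennreal (- f t) \<noteq> \<infinity>"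
    using neg by (intro nn_integral_PInf_AE) auto
  with le have fr: "AE t in M. f t = ereal (r t)"
    unfolding r_def
  proof eventually_elim
    case (elim t)
    then show ?case by (cases "f t") (auto simp: e2ennreal_infty)
  qed
  have int_r: "integrable M r"
    unfolding real_integrable_def
  proof (intro conjI)
    show "r \<in> borel_measurable M" unfolding r_def by measurable
    have "(\<integral>\<^sup>+t. ennreal (r t) \<partial>M) = (\<integral>\<^sup>+t. e2ennreal (f t) \<partial>M)"
      using fr by (intro nn_integral_cong_AE) (auto simp: e2ennreal_ereal)
    then show "(\<integral>\<^sup>+t. ennreal (r t) \<partial>M) \<noteq> \<infinity>" using pos by simp
    have "(\<integral>\<^sup>+t. ennreal (- r t) \<partial>M) = (\<integral>\<^sup>+t. e2ennreal (- f t) \<partial>M)"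
      using fr by (intro nn_integral_cong_AE) (auto simp: e2ennreal_ereal)
    then show "(\<integral>\<^sup>+t. ennreal (- r t) \<partial>M) \<noteq> \<infinity>" using neg by simp
  qed
  have "ereal (integral\<^sup>L M r) = ereal (integral\<^sup>L M g)"
    using ereal_integral_cong_AE[OF fr] ereal_integral_real[OF int_r] eq by simp
  then have "integral\<^sup>L M (\<lambda>t. g t - r t) = 0"
    using g int_r by simp
  moreover have "AE t in M. 0 \<le> g t - r t" using le fr by eventually_elim simp
  ultimately have "AE t in M. g t - r t = 0"
    using g int_r by (subst (asm) integral_nonneg_eq_0_iff_AE) auto
  with fr show ?thesis by eventually_elim simp
qed

section \<open>Equality cases of the three conjugate functionals\<close>

lemma INF_closure_eq:
  fixes f :: "'a::topological_space \<Rightarrow> real"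
  assumes "continuous_on UNIV f" "T \<subseteq> S" "S \<subseteq> closure T"
  shows "(INF z\<in>S. ereal (f z)) = (INF z\<in>T. ereal (f z))"
proof (rule antisym)
  show "(INF z\<in>S. ereal (f z)) \<le> (INF z\<in>T. ereal (f z))"
    using assms(2) by (rule INF_superset_mono) simp
  show "(INF z\<in>T. ereal (f z)) \<le> (INF z\<in>S. ereal (f z))"
  proof (rule INF_greatest)
    fix z assume "z \<in> S"
    have "closed ((\<lambda>z. ereal (f z)) -` {(INF z\<in>T. ereal (f z))..})"
      using assms(1) by (intro closed_vimage continuous_on_ereal) auto
    moreover have "T \<subseteq> (\<lambda>z. ereal (f z)) -` {(INF z\<in>T. ereal (f z))..}"
      by (auto intro: INF_lower)
    ultimately have "closure T \<subseteq> (\<lambda>z. ereal (f z)) -` {(INF z\<in>T. ereal (f z))..}"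
      by (rule closure_minimal[rotated])
    then show "(INF z\<in>T. ereal (f z)) \<le> ereal (f z)"
      using \<open>z \<in> S\<close> assms(3) by blast
  qed
qed

text \<open>
  The infimum over the graph may be taken over a countable dense subset, since the function under it is
  continuous.
\<close>

lemma borel_measurable_M_fun:
  fixes a b w :: "'t \<Rightarrow> 'a::euclidean_space"
  assumes [measurable]: "a \<in> borel_measurable M" "b \<in> borel_measurable M" "w \<in> borel_measurable M"
  shows "(\<lambda>t. M_fun F (a t) (b t) (w t)) \<in> borel_measurable M"
proof -
  obtain T where T: "countable T" "T \<subseteq> gph F" "gph F \<subseteq> closure T" by (rule separable)
  let ?f = "\<lambda>t z. fst z \<bullet> a t + fst (snd z) \<bullet> b t - snd (snd z) \<bullet> w t"
  have "M_fun F (a t) (b t) (w t) = (INF z\<in>T. ereal (?f t z))" for t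
  proof -
    have "M_fun F (a t) (b t) (w t) = (INF z\<in>gph F. ereal (?f t z))"
      by (simp add: M_fun_def split_def)
    also have "\<dots> = (INF z\<in>T. ereal (?f t z))"
      using T by (intro INF_closure_eq continuous_intros) auto
    finally show ?thesis .
  qed
  moreover have "(\<lambda>t. INF z\<in>T. ereal (?f t z)) \<in> borel_measurable M"
    using T(1) by (intro borel_measurable_INF) measurable
  ultimately show ?thesis by simp
qed

lemma M_fun_le:
  assumes "v \<in> F x v1"
  shows "M_fun F a b w \<le> ereal (x \<bullet> a + v1 \<bullet> b - v \<bullet> w)"
  unfolding M_fun_def using assms by (intro INF_lower2[of "(x, v1, v)"]) (auto simp: gph_def)

text \<open>
  The locally adjoint mapping consists of the normals for which the point of the graph attains the
  infimum.
\<close>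

lemma M_fun_eq_iff_locally_adjoint:
  assumes "v \<in> F x v1"
  shows "M_fun F a b w = ereal (x \<bullet> a + v1 \<bullet> b - v \<bullet> w) \<longleftrightarrow> (a, b) \<in> locally_adjoint F w (x, v1, v)"
proof -
  have "M_fun F a b w = ereal (x \<bullet> a + v1 \<bullet> b - v \<bullet> w)
      \<longleftrightarrow> ereal (x \<bullet> a + v1 \<bullet> b - v \<bullet> w) \<le> M_fun F a b w"
    using M_fun_le[of v F x v1 a b w, OF assms] by auto
  also have "\<dots> \<longleftrightarrow> (a, b) \<in> locally_adjoint F w (x, v1, v)"
    by (auto simp: M_fun_def le_INF_iff locally_adjoint_def dual_tangent_cone_iff
        inner_diff_left algebra_simps split: prod.splits)
  finally show ?thesis .
qed

lemma support_fun_ge: "z \<in> Q \<Longrightarrow> ereal (z \<bullet> p) \<le> support_fun Q p"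
  unfolding support_fun_def by (rule SUP_upper)

lemma support_fun_eq_iff_dual_tangent_cone:
  assumes "z \<in> Q"
  shows "support_fun Q p = ereal (z \<bullet> p) \<longleftrightarrow> - p \<in> dual_tangent_cone Q z"
proof -
  have "support_fun Q p = ereal (z \<bullet> p) \<longleftrightarrow> support_fun Q p \<le> ereal (z \<bullet> p)"
    using support_fun_ge[OF assms, of p] by auto
  also have "\<dots> \<longleftrightarrow> - p \<in> dual_tangent_cone Q z"
    by (auto simp: support_fun_def SUP_le_iff dual_tangent_cone_iff inner_diff_left)
  finally show ?thesis .
qed

lemma conjugate_ge: "ereal (z \<bullet> p - f z) \<le> conjugate f p"
  unfolding conjugate_def by (rule SUP_upper) simp

lemma conjugate_eq_iff_subdifferential:
  "conjugate f p = ereal (z \<bullet> p - f z) \<longleftrightarrow> p \<in> subdifferential f z"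
proof -
  have "conjugate f p = ereal (z \<bullet> p - f z) \<longleftrightarrow> conjugate f p \<le> ereal (z \<bullet> p - f z)"
    using conjugate_ge[of z p f] by auto
  also have "\<dots> \<longleftrightarrow> p \<in> subdifferential f z"
    by (auto simp: conjugate_def SUP_le_iff subdifferential_def inner_diff_left algebra_simps)
  finally show ?thesis .
qed

text \<open>
  In a sum of one-sided estimates with finite bounds no \<open>\<infinity> - \<infinity>\<close> arises, and the sum is exact iff
  every estimate is exact.
\<close>

lemma ereal_sum_of_bounds:
  fixes c i w0 w1 :: real
  assumes "ereal c \<le> C" "I \<le> ereal i" "ereal w0 \<le> W0" "ereal w1 \<le> W1"
  shows "- C + I - W0 - W1 \<le> ereal (- c + i - w0 - w1)"
    and "- C + I - W0 - W1 = ereal (- c + i - w0 - w1) \<longleftrightarrow> C = c \<and> I = i \<and> W0 = w0 \<and> W1 = w1"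
  using assms by (cases C; cases I; cases W0; cases W1; auto)+

section \<open>Absolutely continuous functions\<close>

lemma division_endpoints_mem:
  fixes K :: "real set"
  assumes "D division_of T" "K \<in> D"
  shows "Inf K \<in> K" "Sup K \<in> K" "Inf K \<le> Sup K" "K = {Inf K..Sup K}" "K \<subseteq> T"
proof -
  obtain a b where "K = {a..b}" "K \<noteq> {}" "K \<subseteq> T"
    using division_ofD(2,3,4)[OF assms] by (metis box_real(2))
  then show "Inf K \<in> K" "Sup K \<in> K" "Inf K \<le> Sup K" "K = {Inf K..Sup K}" "K \<subseteq> T" by auto
qed

lemma abs_continuous_on_cong:
  assumes "\<And>t. t \<in> S \<Longrightarrow> f t = g t"
  shows "abs_continuous_on S f \<longleftrightarrow> abs_continuous_on S g"
proof -
  have *: "(\<Sum>K\<in>D. norm (f (Sup K) - f (Inf K))) = (\<Sum>K\<in>D. norm (g (Sup K) - g (Inf K)))"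
    if "D division_of T" "T \<subseteq> S" for D T
  proof (rule sum.cong)
    fix K assume "K \<in> D"
    then have "Inf K \<in> S" "Sup K \<in> S"
      using division_endpoints_mem[OF that(1)] that(2) by blast+
    then show "norm (f (Sup K) - f (Inf K)) = norm (g (Sup K) - g (Inf K))"
      using assms by simp
  qed simp
  have "(D division_of T \<and> T \<subseteq> S \<and> (\<Sum>K\<in>D. measure lborel K) < \<delta>
          \<longrightarrow> (\<Sum>K\<in>D. norm (f (Sup K) - f (Inf K))) < \<epsilon>)
      \<longleftrightarrow> (D division_of T \<and> T \<subseteq> S \<and> (\<Sum>K\<in>D. measure lborel K) < \<delta>
          \<longrightarrow> (\<Sum>K\<in>D. norm (g (Sup K) - g (Inf K))) < \<epsilon>)" for D T \<delta> \<epsilon>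
    using *[of D T] by auto
  then show ?thesis
    unfolding abs_continuous_on_def by (simp only:)
qed

lemma abs_continuous_onE:
  assumes "abs_continuous_on S f" "0 < \<epsilon>"
  obtains \<delta> where "\<delta> > 0" "\<And>D T. D division_of T \<Longrightarrow> T \<subseteq> S \<Longrightarrow>
      (\<Sum>K\<in>D. measure lborel K) < \<delta> \<Longrightarrow> (\<Sum>K\<in>D. norm (f (Sup K) - f (Inf K))) < \<epsilon>"
proof -
  from assms obtain \<delta> where "\<delta> > 0" and \<delta>: "\<forall>D T. D division_of T \<and> T \<subseteq> S \<and>
      (\<Sum>K\<in>D. measure lborel K) < \<delta> \<longrightarrow> (\<Sum>K\<in>D. norm (f (Sup K) - f (Inf K))) < \<epsilon>"
    unfolding abs_continuous_on_def by blast
  show thesis by (rule that[OF \<open>\<delta> > 0\<close>]) (rule \<delta>[rule_format], simp)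
qed

lemma abs_continuous_on_imp_continuous_on:
  assumes "abs_continuous_on {a..b} f"
  shows "continuous_on {a..b} f"
proof (unfold continuous_on_iff, intro ballI allI impI)
  fix s \<epsilon> :: real assume s: "s \<in> {a..b}" and "0 < \<epsilon>"
  obtain \<delta> where "\<delta> > 0" and \<delta>: "\<And>D T. D division_of T \<Longrightarrow> T \<subseteq> {a..b} \<Longrightarrow>
      (\<Sum>K\<in>D. measure lborel K) < \<delta> \<Longrightarrow> (\<Sum>K\<in>D. norm (f (Sup K) - f (Inf K))) < \<epsilon>"
    using abs_continuous_onE[OF assms \<open>0 < \<epsilon>\<close>] by blast
  show "\<exists>d>0. \<forall>t\<in>{a..b}. dist t s < d \<longrightarrow> dist (f t) (f s) < \<epsilon>"
  proof (intro exI conjI ballI impI)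
    fix t assume t: "t \<in> {a..b}" "dist t s < \<delta>"
    define u v where "u = min s t" and "v = max s t"
    have uv: "u \<le> v" "{u..v} \<subseteq> {a..b}" "v - u < \<delta>"
      using s t by (auto simp: u_def v_def dist_real_def)
    have "{{u..v}} division_of {u..v}"
      using uv(1) by (metis box_real(2) division_of_self atLeastatMost_empty_iff not_le)
    from \<delta>[OF this uv(2)] uv have "norm (f v - f u) < \<epsilon>" by simp
    then show "dist (f t) (f s) < \<epsilon>"
      by (auto simp: u_def v_def dist_norm norm_minus_commute min_def max_def split: if_splits)
  qed fact
qed

lemma abs_continuous_on_minus:
  "abs_continuous_on S (\<lambda>t. - f t) \<longleftrightarrow> abs_continuous_on S f"
proof -
  have "norm (- f v - - f u) = norm (f v - f u)" for u v
    by (simp add: norm_minus_commute)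
  then show ?thesis unfolding abs_continuous_on_def by (simp only:)
qed

lemma abs_continuous_on_add:
  assumes "abs_continuous_on S f" "abs_continuous_on S g"
  shows "abs_continuous_on S (\<lambda>t. f t + g t)"
  unfolding abs_continuous_on_def
proof (intro allI impI)
  fix \<epsilon> :: real assume "0 < \<epsilon>"
  then have "\<epsilon>/2 > 0" by simp
  obtain \<delta>1 where \<delta>1: "\<delta>1 > 0"
    and f: "\<And>D T. D division_of T \<Longrightarrow> T \<subseteq> S \<Longrightarrow> (\<Sum>K\<in>D. measure lborel K) < \<delta>1 \<Longrightarrow>
              (\<Sum>K\<in>D. norm (f (Sup K) - f (Inf K))) < \<epsilon>/2"
    by (rule abs_continuous_onE[OF assms(1) \<open>\<epsilon>/2 > 0\<close>]) blast
  obtain \<delta>2 where \<delta>2: "\<delta>2 > 0"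
    and g: "\<And>D T. D division_of T \<Longrightarrow> T \<subseteq> S \<Longrightarrow> (\<Sum>K\<in>D. measure lborel K) < \<delta>2 \<Longrightarrow>
              (\<Sum>K\<in>D. norm (g (Sup K) - g (Inf K))) < \<epsilon>/2"
    by (rule abs_continuous_onE[OF assms(2) \<open>\<epsilon>/2 > 0\<close>]) blast
  show "\<exists>\<delta>>0. \<forall>D T. D division_of T \<and> T \<subseteq> S \<and> (\<Sum>K\<in>D. measure lborel K) < \<delta> \<longrightarrow>
          (\<Sum>K\<in>D. norm (f (Sup K) + g (Sup K) - (f (Inf K) + g (Inf K)))) < \<epsilon>"
  proof (intro exI[of _ "min \<delta>1 \<delta>2"] conjI allI impI; (elim conjE)?)
    fix D T assume D: "D division_of T" "T \<subseteq> S" "(\<Sum>K\<in>D. measure lborel K) < min \<delta>1 \<delta>2"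
    have "(\<Sum>K\<in>D. norm (f (Sup K) + g (Sup K) - (f (Inf K) + g (Inf K))))
        \<le> (\<Sum>K\<in>D. norm (f (Sup K) - f (Inf K)) + norm (g (Sup K) - g (Inf K)))"
      by (intro sum_mono) (metis add_diff_add norm_triangle_ineq)
    also have "\<dots> < \<epsilon>"
      using f[OF D(1,2)] g[OF D(1,2)] D(3) by (simp add: sum.distrib)
    finally show "(\<Sum>K\<in>D. norm (f (Sup K) + g (Sup K) - (f (Inf K) + g (Inf K)))) < \<epsilon>" .
  qed (use \<delta>1 \<delta>2 in auto)
qed

text \<open>
  Both factors are bounded on the compact interval, so the increments of the product are bounded by a
  combination of the increments of the factors.
\<close>

lemma abs_continuous_on_inner:
  fixes f g :: "real \<Rightarrow> 'a::euclidean_space"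
  assumes f: "abs_continuous_on {a..b} f" and g: "abs_continuous_on {a..b} g"
  shows "abs_continuous_on {a..b} (\<lambda>t. f t \<bullet> g t)"
  unfolding abs_continuous_on_def
proof (intro allI impI)
  fix \<epsilon> :: real assume "0 < \<epsilon>"
  have "compact (f ` {a..b})" "compact (g ` {a..b})"
    using abs_continuous_on_imp_continuous_on f g by (auto intro: compact_continuous_image)
  then obtain M N where "M > 0" "N > 0"
    and M: "\<And>t. t \<in> {a..b} \<Longrightarrow> norm (f t) \<le> M" and N: "\<And>t. t \<in> {a..b} \<Longrightarrow> norm (g t) \<le> N"
    by (metis bounded_pos compact_imp_bounded imageI)
  have "\<epsilon>/(2*N) > 0" "\<epsilon>/(2*M) > 0" using \<open>0 < \<epsilon>\<close> \<open>M > 0\<close> \<open>N > 0\<close> by simp_all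
  obtain \<delta>1 where \<delta>1: "\<delta>1 > 0"
    and f: "\<And>D T. D division_of T \<Longrightarrow> T \<subseteq> {a..b} \<Longrightarrow> (\<Sum>K\<in>D. measure lborel K) < \<delta>1 \<Longrightarrow>
              (\<Sum>K\<in>D. norm (f (Sup K) - f (Inf K))) < \<epsilon>/(2*N)"
    by (rule abs_continuous_onE[OF f \<open>\<epsilon>/(2*N) > 0\<close>]) blast
  obtain \<delta>2 where \<delta>2: "\<delta>2 > 0"
    and g: "\<And>D T. D division_of T \<Longrightarrow> T \<subseteq> {a..b} \<Longrightarrow> (\<Sum>K\<in>D. measure lborel K) < \<delta>2 \<Longrightarrow>
              (\<Sum>K\<in>D. norm (g (Sup K) - g (Inf K))) < \<epsilon>/(2*M)"
    by (rule abs_continuous_onE[OF g \<open>\<epsilon>/(2*M) > 0\<close>]) blast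
  show "\<exists>\<delta>>0. \<forall>D T. D division_of T \<and> T \<subseteq> {a..b} \<and> (\<Sum>K\<in>D. measure lborel K) < \<delta> \<longrightarrow>
          (\<Sum>K\<in>D. norm (f (Sup K) \<bullet> g (Sup K) - f (Inf K) \<bullet> g (Inf K))) < \<epsilon>"
  proof (intro exI[of _ "min \<delta>1 \<delta>2"] conjI allI impI; (elim conjE)?)
    fix D T assume D: "D division_of T" "T \<subseteq> {a..b}" "(\<Sum>K\<in>D. measure lborel K) < min \<delta>1 \<delta>2"
    have "(\<Sum>K\<in>D. norm (f (Sup K) \<bullet> g (Sup K) - f (Inf K) \<bullet> g (Inf K)))
        \<le> (\<Sum>K\<in>D. N * norm (f (Sup K) - f (Inf K)) + M * norm (g (Sup K) - g (Inf K)))"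
    proof (rule sum_mono)
      fix K assume "K \<in> D"
      then have mem: "Inf K \<in> {a..b}" "Sup K \<in> {a..b}"
        using division_endpoints_mem[OF D(1)] D(2) by blast+
      have "norm (f (Sup K) \<bullet> g (Sup K) - f (Inf K) \<bullet> g (Inf K))
          = norm ((f (Sup K) - f (Inf K)) \<bullet> g (Sup K) + f (Inf K) \<bullet> (g (Sup K) - g (Inf K)))"
        by (simp add: inner_diff_left inner_diff_right)
      also have "\<dots> \<le> norm (f (Sup K) - f (Inf K)) * norm (g (Sup K))
          + norm (f (Inf K)) * norm (g (Sup K) - g (Inf K))"
        unfolding real_norm_def
        by (intro order_trans[OF abs_triangle_ineq] add_mono Cauchy_Schwarz_ineq2)
      also have "\<dots> \<le> N * norm (f (Sup K) - f (Inf K)) + M * norm (g (Sup K) - g (Inf K))"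
        unfolding mult.commute[of N] using M[OF mem(1)] N[OF mem(2)]
          by (intro add_mono mult_left_mono mult_right_mono) auto
      finally show "norm (f (Sup K) \<bullet> g (Sup K) - f (Inf K) \<bullet> g (Inf K))
          \<le> N * norm (f (Sup K) - f (Inf K)) + M * norm (g (Sup K) - g (Inf K))" .
    qed
    also have "\<dots> = N * (\<Sum>K\<in>D. norm (f (Sup K) - f (Inf K))) + M * (\<Sum>K\<in>D. norm (g (Sup K) - g (Inf K)))"
      by (simp add: sum.distrib sum_distrib_left)
    also have "\<dots> < N * (\<epsilon>/(2*N)) + M * (\<epsilon>/(2*M))"
      using f[OF D(1,2)] g[OF D(1,2)] D(3) \<open>M > 0\<close> \<open>N > 0\<close>
      by (intro add_strict_mono mult_strict_left_mono) auto
    also have "\<dots> = \<epsilon>" using \<open>M > 0\<close> \<open>N > 0\<close> by simp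
    finally show "(\<Sum>K\<in>D. norm (f (Sup K) \<bullet> g (Sup K) - f (Inf K) \<bullet> g (Inf K))) < \<epsilon>" .
  qed (use \<delta>1 \<delta>2 in auto)
qed

lemma sum_length_division_le:
  fixes D :: "real set set"
  assumes D: "D division_of T" and "T \<subseteq> U" "open U" "U \<in> lmeasurable"
  shows "(\<Sum>K\<in>D. measure lborel K) \<le> measure lebesgue U"
proof -
  have "(\<Sum>K\<in>D. measure lborel K) = (\<Sum>K\<in>D. measure lebesgue (interior K))"
  proof (rule sum.cong)
    fix K assume "K \<in> D"
    from division_endpoints_mem[OF D this] obtain u v where "K = {u..v}" "u \<le> v" by blast
    then show "measure lborel K = measure lebesgue (interior K)" by (simp add: interior_atLeastAtMost_real)
  qed simp
  also have "\<dots> = measure lebesgue (\<Union>K\<in>D. interior K)"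
  proof (rule measure_finite_Union[symmetric])
    show "finite D" using D by blast
    show "interior ` D \<subseteq> sets lebesgue" by auto
    show "disjoint_family_on interior D"
      using division_ofD(5)[OF D] by (auto simp: disjoint_family_on_def)
    fix K assume "K \<in> D"
    from division_endpoints_mem[OF D this] obtain u v where "K = {u..v}" "u \<le> v" by blast
    then show "emeasure lebesgue (interior K) \<noteq> \<infinity>" by (simp add: interior_atLeastAtMost_real)
  qed
  also have "\<dots> \<le> measure lebesgue U"
  proof (rule measure_mono_fmeasurable)
    show "(\<Union>K\<in>D. interior K) \<subseteq> U"
      using division_ofD(2)[OF D] assms(2) interior_subset by blast
    show "(\<Union>K\<in>D. interior K) \<in> sets lebesgue"
      by (simp add: borel_open open_UN)
  qed fact
  finally show ?thesis .
qed

text \<open>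
  The fundamental theorem of calculus for absolutely continuous functions, proved with gauges. At a
  point of differentiability the gauge makes the increment close to the linear one, up to a fraction of
  the length. The null set \<open>N\<close> is covered by an open set shorter than the \<open>\<delta>\<close> of absolute continuity,
  and the gauge at points of \<open>N\<close> stays inside it; so all intervals tagged in \<open>N\<close> together contribute
  a small increment, while the integrand may be taken to be \<open>0\<close> there.
\<close>

theorem abs_continuous_has_integral:
  fixes f :: "real \<Rightarrow> 'a::euclidean_space"
  assumes "a \<le> b" and ac: "abs_continuous_on {a..b} f" and N: "negligible N"
    and f': "\<And>t. t \<in> {a..b} - N \<Longrightarrow> (f has_vector_derivative f' t) (at t within {a..b})"
  shows "(f' has_integral f b - f a) {a..b}"
proof -
  define h where "h t = (if t \<in> N then 0 else f' t)" for t
  have "(h has_integral f b - f a) {a..b}"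
    unfolding has_integral_real
  proof (intro allI impI)
    fix \<epsilon> :: real assume "\<epsilon> > 0"
    \<comment> \<open>the tags outside \<open>N\<close> contribute at most \<open>e * (b - a)\<close>; the added \<open>1\<close> covers \<open>a = b\<close>\<close>
    define e where "e = \<epsilon> / (2 * (b - a + 1))"
    have "e > 0" and e: "e * (b - a) < \<epsilon>/2"
      using \<open>\<epsilon> > 0\<close> \<open>a \<le> b\<close> by (auto simp: e_def field_simps)
    obtain \<delta> where "\<delta> > 0" and \<delta>: "\<And>D T. D division_of T \<Longrightarrow> T \<subseteq> {a..b} \<Longrightarrow>
        (\<Sum>K\<in>D. measure lborel K) < \<delta> \<Longrightarrow> (\<Sum>K\<in>D. norm (f (Sup K) - f (Inf K))) < \<epsilon>/2"
      by (rule abs_continuous_onE[OF ac half_gt_zero[OF \<open>\<epsilon> > 0\<close>]]) blast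
    obtain U where U: "open U" "N \<subseteq> U" "U \<in> lmeasurable" "measure lebesgue U < \<delta>"
    proof -
      obtain U where U: "open U" "N \<subseteq> U" "U - N \<in> lmeasurable" "emeasure lebesgue (U - N) < ennreal \<delta>"
        using sets_lebesgue_outer_open[of N \<delta>] N \<open>\<delta> > 0\<close> by (auto simp: negligible_imp_sets)
      have eq: "U = (U - N) \<union> N" using U by blast
      have UL: "U \<in> lmeasurable"
        using U(3) N negligible_imp_measurable by (subst eq) (rule fmeasurable.Un)
      have "measure lebesgue U = measure lebesgue (U - N)"
        using UL N by (simp add: measure_Diff_null_set negligible_iff_null_sets fmeasurableD)
      also have "\<dots> < \<delta>"
        using U(3,4) \<open>\<delta> > 0\<close> by (simp add: emeasure_eq_measure2 ennreal_less_iff)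
      finally show thesis using that U UL by blast
    qed
    have "\<exists>d>0. (t \<in> N \<longrightarrow> ball t d \<subseteq> U) \<and> (t \<in> {a..b} - N \<longrightarrow>
         (\<forall>y\<in>{a..b}. norm (y-t) < d \<longrightarrow> norm (f y - f t - (y-t) *\<^sub>R f' t) \<le> e * norm (y-t)))" for t
    proof (cases "t \<in> N")
      case True
      then show ?thesis using U(1,2) open_contains_ball by blast
    next
      case False
      then show ?thesis
        using f'[of t] \<open>e > 0\<close>
        unfolding has_vector_derivative_def has_derivative_within_alt
        by (cases "t \<in> {a..b}") (auto intro: zero_less_one)
    qed
    then obtain d where d: "\<And>t. d t > 0" "\<And>t. t \<in> N \<Longrightarrow> ball t (d t) \<subseteq> U"
      "\<And>t y. \<lbrakk>t \<in> {a..b} - N; y \<in> {a..b}; norm (y-t) < d t\<rbrakk>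
          \<Longrightarrow> norm (f y - f t - (y-t) *\<^sub>R f' t) \<le> e * norm (y-t)"
      by metis
    show "\<exists>\<gamma>. gauge \<gamma> \<and> (\<forall>p. p tagged_division_of {a..b} \<and> \<gamma> fine p \<longrightarrow>
        norm ((\<Sum>(t,K)\<in>p. measure lborel K *\<^sub>R h t) - (f b - f a)) < \<epsilon>)"
    proof (intro exI conjI allI impI; (elim conjE)?)
      show "gauge (\<lambda>t. ball t (d t))" using d(1) gauge_ball_dependent by blast
      fix p assume p: "p tagged_division_of {a..b}" and fine: "(\<lambda>t. ball t (d t)) fine p"
      have "finite p" using p by blast
      define P where "P = p \<inter> {(t,K). t \<in> N}"
      have Pp: "P \<subseteq> p" by (auto simp: P_def)
      have interval: "\<exists>u v. K = {u..v} \<and> u \<le> v \<and> t \<in> {u..v} \<and> {u..v} \<subseteq> {a..b} \<and> {u..v} \<subseteq> ball t (d t)"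
        if tK: "(t,K) \<in> p" for t K
      proof -
        obtain u v where K: "K = {u..v}" using tagged_division_ofD(4)[OF p tK] by auto
        moreover have "t \<in> K" "K \<subseteq> {a..b}" "K \<subseteq> ball t (d t)"
          using tagged_division_ofD(2,3)[OF p tK] fine tK by (auto simp: fine_def)
        ultimately show ?thesis by (intro exI[of _ u] exI[of _ v]) auto
      qed
      let ?E = "\<lambda>(t,K). measure lborel K *\<^sub>R h t - (f (Sup K) - f (Inf K))"
      have smooth: "norm (?E (t,K)) \<le> e * (Sup K - Inf K)" if tK: "(t,K) \<in> p - P" for t K
      proof -
        obtain u v where K: "K = {u..v}" "u \<le> v" "t \<in> {u..v}" "{u..v} \<subseteq> {a..b}" "{u..v} \<subseteq> ball t (d t)"
          using interval tK by blast
        have t: "t \<in> {a..b} - N" using tK K by (auto simp: P_def)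
        have end_bound: "norm (f y - f t - (y-t) *\<^sub>R f' t) \<le> e * norm (y-t)" if "y \<in> {u..v}" for y
        proof (rule d(3)[OF t])
          show "y \<in> {a..b}" "norm (y - t) < d t"
            using that K(4,5) by (auto simp: dist_norm norm_minus_commute subset_iff)
        qed
        have "norm (?E (t,K)) = norm ((f u - f t - (u - t) *\<^sub>R f' t) - (f v - f t - (v - t) *\<^sub>R f' t))"
          using K t by (simp add: h_def algebra_simps)
        also have "\<dots> \<le> e * norm (u - t) + e * norm (v - t)"
          using K(2) by (intro order_trans[OF norm_triangle_ineq4] add_mono end_bound) auto
        also have "\<dots> = e * (Sup K - Inf K)"
          using K by (simp add: field_simps)
        finally show ?thesis .
      qed
      have exceptional: "(\<Sum>(t,K)\<in>P. norm (f (Sup K) - f (Inf K))) < \<epsilon>/2"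
      proof -
        have tpd: "P tagged_partial_division_of {a..b}"
          using p Pp by (meson tagged_division_of_def tagged_partial_division_subset)
        define D where "D = snd ` P"
        have div: "D division_of \<Union>D"
          unfolding D_def by (rule partial_division_of_tagged_division[OF tpd])
        have sub: "\<Union>D \<subseteq> {a..b}" "\<Union>D \<subseteq> U"
          using interval d(2) unfolding D_def P_def by fastforce+
        have nonempty: "(t,{}) \<notin> P" for t
          using tagged_division_ofD(2)[OF p] Pp by blast
        have "(\<Sum>(t,K)\<in>P. norm (f (Sup K) - f (Inf K)))
            = (\<Sum>(t,K)\<in>P. if K = {} then 0 else norm (f (Sup K) - f (Inf K)))"
          using nonempty by (intro sum.cong) auto
        \<comment> \<open>an interval with several tags is degenerate and contributes \<open>0\<close>; \<open>Sup {}\<close> has no such guarantee\<close>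
        also have "\<dots> = (\<Sum>K\<in>D. if K = {} then 0 else norm (f (Sup K) - f (Inf K)))"
          unfolding D_def
          by (rule sum.over_tagged_division_lemma[OF tagged_partial_division_of_Union_self[OF tpd]])
             (auto simp: box_eq_empty)
        also have "\<dots> = (\<Sum>K\<in>D. norm (f (Sup K) - f (Inf K)))"
          using division_ofD(3)[OF div] by (intro sum.cong) auto
        also have "\<dots> < \<epsilon>/2"
          using sum_length_division_le[OF div sub(2) U(1,3)] U(4) by (intro \<delta>[OF div sub(1)]) simp
        finally show ?thesis .
      qed
      have sums: "b - a = (\<Sum>(t,K)\<in>p. Sup K - Inf K)" "f b - f a = (\<Sum>(t,K)\<in>p. f (Sup K) - f (Inf K))"
        using additive_tagged_division_1[OF \<open>a \<le> b\<close> p, of "\<lambda>x. x"]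
          additive_tagged_division_1[OF \<open>a \<le> b\<close> p, of f] by simp_all
      have "(\<Sum>(t,K)\<in>p. measure lborel K *\<^sub>R h t) - (f b - f a) = sum ?E p"
        by (simp add: sums(2) split_def sum_subtractf)
      also have "\<dots> = sum ?E (p - P) + sum ?E P"
        by (rule sum.subset_diff[OF Pp \<open>finite p\<close>])
      finally have "norm ((\<Sum>(t,K)\<in>p. measure lborel K *\<^sub>R h t) - (f b - f a)) \<le> norm (sum ?E (p - P)) + norm (sum ?E P)"
        by (simp add: norm_triangle_ineq)
      also have "norm (sum ?E (p - P)) \<le> (\<Sum>(t,K)\<in>p - P. e * (Sup K - Inf K))"
        using smooth by (intro sum_norm_le) auto
      also have "\<dots> \<le> (\<Sum>(t,K)\<in>p. e * (Sup K - Inf K))"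
        using interval \<open>e > 0\<close> \<open>finite p\<close> by (intro sum_mono2) fastforce+
      also have "\<dots> = e * (b - a)"
        by (simp add: sums(1) sum_distrib_left split_def)
      also have "norm (sum ?E P) \<le> (\<Sum>(t,K)\<in>P. norm (f (Sup K) - f (Inf K)))"
        by (intro sum_norm_le) (auto simp: P_def h_def norm_minus_commute)
      finally show "norm ((\<Sum>(t,K)\<in>p. measure lborel K *\<^sub>R h t) - (f b - f a)) < \<epsilon>"
        using exceptional e by linarith
    qed
  qed
  then show ?thesis
    by (rule has_integral_spike[OF N, rotated]) (simp add: h_def)
qed

section \<open>Derivatives on the unit interval\<close>

lemma D01_works:
  "f differentiable (at t within {0..1}) \<Longrightarrow> (f has_vector_derivative D01 f t) (at t within {0..1})"
  unfolding D01_def by (simp add: vector_derivative_works)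

lemma D01_eqI:
  "t \<in> {0..1} \<Longrightarrow> (f has_vector_derivative f') (at t within {0..1}) \<Longrightarrow> D01 f t = f'"
  unfolding D01_def using vector_derivative_within_cbox[of 0 1 t f f'] by (simp add: box_real)

lemma D01_minus:
  assumes "t \<in> {0..1}" "f differentiable (at t within {0..1})"
  shows "D01 (\<lambda>t. - f t) t = - D01 f t"
  using D01_works[OF assms(2)] by (intro D01_eqI[OF assms(1)] has_vector_derivative_minus)

lemma D01_cong:
  assumes "\<And>t. t \<in> {0..1} \<Longrightarrow> f t = g t" "t \<in> {0..1}"
  shows "D01 f t = D01 g t"
  unfolding D01_def using assms by (intro vector_derivative_cong_eq always_eventually) auto

lemma differentiable_01_cong:
  assumes "\<And>t. t \<in> {0..1} \<Longrightarrow> f t = g t" "t \<in> {0..1}"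
  shows "f differentiable (at t within {0..1}) \<longleftrightarrow> g differentiable (at t within {0..1})"
  using assms by (metis differentiable_transform_within zero_less_one)

lemma AE_lebesgue_on_iff_negligible:
  assumes "S \<in> sets lebesgue"
  shows "(AE t in lebesgue_on S. P t) \<longleftrightarrow> (\<exists>N. negligible N \<and> (\<forall>t\<in>S - N. P t))"
proof -
  have "(AE t in lebesgue_on S. P t) \<longleftrightarrow> {t. \<not> (t \<in> S \<longrightarrow> P t)} \<in> null_sets lebesgue"
    using assms by (simp add: AE_restrict_space_iff completion.AE_iff_null_sets)
  also have "\<dots> \<longleftrightarrow> (\<exists>N. negligible N \<and> (\<forall>t\<in>S - N. P t))"
    unfolding negligible_iff_null_sets[symmetric]
    by (auto intro: negligible_subset)
  finally show ?thesis .
qed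

lemma AE_01_cong:
  assumes "\<And>t. t \<in> {0..1} \<Longrightarrow> P t \<longleftrightarrow> Q t"
  shows "(AE t in lebesgue_on {0..1::real}. P t) \<longleftrightarrow> (AE t in lebesgue_on {0..1}. Q t)"
  using assms by (intro AE_cong) simp

text \<open>
  Needed since \<open>C\<^sup>*\<lambda>\<close> and \<open>B\<^sup>*\<lambda>\<close> can be prescribed on the unit interval only: outside it, the given
  functions need not lie in the cones of attainable values.
\<close>

lemma AC1_cong:
  assumes eq: "\<And>t. t \<in> {0..1} \<Longrightarrow> f t = g t"
  shows "AC1 f \<longleftrightarrow> AC1 g"
proof -
  have "D01 f absolutely_integrable_on {0..1} \<longleftrightarrow> D01 g absolutely_integrable_on {0..1}"
    by (intro absolutely_integrable_spike_eq[OF negligible_empty]) (auto intro: D01_cong eq[symmetric])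
  moreover have "(AE t in lebesgue_on {0..1}. f differentiable (at t within {0..1}))
      \<longleftrightarrow> (AE t in lebesgue_on {0..1}. g differentiable (at t within {0..1}))"
    by (intro AE_01_cong differentiable_01_cong eq)
  moreover have "abs_continuous_on {0..1} f \<longleftrightarrow> abs_continuous_on {0..1} g"
    by (intro abs_continuous_on_cong eq)
  ultimately show ?thesis unfolding AC1_def by simp
qed

lemma AC2_cong:
  assumes eq: "\<And>t. t \<in> {0..1} \<Longrightarrow> f t = g t"
  shows "AC2 f \<longleftrightarrow> AC2 g"
  unfolding AC2_def
  using abs_continuous_on_cong[of "{0..1}" f g] AC1_cong[of "D01 f" "D01 g"] D01_cong[of f g]
    differentiable_01_cong[of f g] eq by simp

lemma absolutely_integrable_cong_AE:
  fixes f g :: "'b::euclidean_space \<Rightarrow> 'a::euclidean_space"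
  assumes "S \<in> sets lebesgue" "AE t in lebesgue_on S. f t = g t" "f absolutely_integrable_on S"
  shows "g absolutely_integrable_on S"
proof -
  obtain N where "negligible N" "\<And>t. t \<in> S - N \<Longrightarrow> f t = g t"
    using assms(2) unfolding AE_lebesgue_on_iff_negligible[OF assms(1)] by blast
  then show ?thesis
    by (intro absolutely_integrable_spike[OF assms(3)]) auto
qed

lemma AC1_minus:
  assumes "AC1 f" shows "AC1 (\<lambda>t. - f t)"
proof -
  have diff: "AE t in lebesgue_on {0..1}. f differentiable (at t within {0..1})"
    using assms by (simp add: AC1_def)
  have "AE t in lebesgue_on {0..1}. - D01 f t = D01 (\<lambda>t. - f t) t"
    using diff AE_space by eventually_elim (simp add: D01_minus)
  moreover have "(\<lambda>t. - D01 f t) absolutely_integrable_on {0..1}"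
    using assms by (simp add: AC1_def absolutely_integrable_measurable o_def)
  ultimately have "D01 (\<lambda>t. - f t) absolutely_integrable_on {0..1}"
    by (rule absolutely_integrable_cong_AE[rotated]) simp
  moreover have "AE t in lebesgue_on {0..1}. (\<lambda>t. - f t) differentiable (at t within {0..1})"
    using diff by eventually_elim simp
  ultimately show ?thesis
    using assms by (simp add: AC1_def abs_continuous_on_minus)
qed

lemma AC2_minus:
  assumes "AC2 f" shows "AC2 (\<lambda>t. - f t)"
proof -
  have "AC1 (D01 (\<lambda>t. - f t)) \<longleftrightarrow> AC1 (\<lambda>t. - D01 f t)"
    using assms by (intro AC1_cong D01_minus) (auto simp: AC2_def)
  with assms show ?thesis by (simp add: AC2_def AC1_minus abs_continuous_on_minus)
qed

lemma regular_multiplier_iff: "regular_multiplier B C l \<longleftrightarrow> AC2 (tmul C l) \<and> AC1 (tmul B l)"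
  unfolding regular_multiplier_def
  using AC2_minus[of "tmul C l"] AC2_minus[of "\<lambda>t. - tmul C l t"]
    AC1_minus[of "tmul B l"] AC1_minus[of "\<lambda>t. - tmul B l t"] by auto

lemma AC1_continuous_on: "AC1 f \<Longrightarrow> continuous_on {0..1} f"
  by (simp add: AC1_def abs_continuous_on_imp_continuous_on)

lemma AC2_continuous_on: "AC2 f \<Longrightarrow> continuous_on {0..1} f" "AC2 f \<Longrightarrow> continuous_on {0..1} (D01 f)"
  by (simp_all add: AC2_def AC1_continuous_on abs_continuous_on_imp_continuous_on)

lemma D01_D01_minus:
  assumes "AC2 f"
  shows "AE t in lebesgue_on {0..1}. D01 (D01 (\<lambda>t. - f t)) t = - D01 (D01 f) t"
proof -
  have "D01 (\<lambda>t. - f t) t = - D01 f t" if "t \<in> {0..1}" for t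
    using assms that by (intro D01_minus) (auto simp: AC2_def)
  then have eq: "D01 (D01 (\<lambda>t. - f t)) t = D01 (\<lambda>t. - D01 f t) t" if "t \<in> {0..1}" for t
    using that by (intro D01_cong) auto
  have "AE t in lebesgue_on {0..1}. D01 f differentiable (at t within {0..1})"
    using assms by (simp add: AC2_def AC1_def)
  with AE_space show ?thesis
  proof eventually_elim
    case (elim t)
    then show ?case using eq[of t] D01_minus[of t "D01 f"] by simp
  qed
qed

lemma absolutely_integrable_continuous_inner:
  fixes f g :: "real \<Rightarrow> 'a::euclidean_space"
  assumes "continuous_on {a..b} f" "g absolutely_integrable_on {a..b}"
  shows "(\<lambda>t. f t \<bullet> g t) absolutely_integrable_on {a..b}"
proof (rule absolutely_integrable_bounded_measurable_product[where h = "(\<bullet>)"])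
  show "bilinear ((\<bullet>) :: 'a \<Rightarrow> 'a \<Rightarrow> real)"
    using bilinear_conv_bounded_bilinear bounded_bilinear_inner by blast
  show "bounded (f ` {a..b})"
    using assms(1) by (intro compact_imp_bounded compact_continuous_image) auto
qed (use assms in \<open>auto intro: continuous_imp_measurable_on_sets_lebesgue\<close>)

text \<open>
  In the derivative of \<open>\<langle>x', p\<rangle> - \<langle>x, p' + q\<rangle>\<close> the two terms \<open>\<langle>x', p'\<rangle>\<close> cancel. Only the sum \<open>p' + q\<close>
  and its derivative occur, the combination which the adjoint equation controls.
\<close>

theorem second_order_integration_by_parts:
  fixes x p q :: "real \<Rightarrow> 'a::euclidean_space"
  assumes x: "AC2 x" and p: "AC2 p" and q: "AC1 q"
  defines "g \<equiv> \<lambda>t. D01 (D01 x) t \<bullet> p t - x t \<bullet> (D01 (D01 p) t + D01 q t) - D01 x t \<bullet> q t"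
    and "b \<equiv> \<lambda>t. D01 x t \<bullet> p t - x t \<bullet> (D01 p t + q t)"
  shows "integrable (lebesgue_on {0..1}) g" "integral\<^sup>L (lebesgue_on {0..1}) g = b 1 - b 0"
proof -
  have cont: "continuous_on {0..1} x" "continuous_on {0..1} (D01 x)" "continuous_on {0..1} p"
      "continuous_on {0..1} q"
    using x p q by (simp_all add: AC2_continuous_on AC1_continuous_on)
  have "(\<lambda>t. p t \<bullet> D01 (D01 x) t - x t \<bullet> (D01 (D01 p) t + D01 q t) - D01 x t \<bullet> q t)
      absolutely_integrable_on {0..1}"
    using x p q cont
    unfolding AC1_def AC2_def
    by (intro set_integral_diff absolutely_integrable_continuous_inner set_integral_add)
      (auto intro: absolutely_integrable_continuous_real)
  then have abs: "g absolutely_integrable_on {0..1}"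
    by (simp add: g_def inner_commute)
  then show int: "integrable (lebesgue_on {0..1}) g"
    by (rule absolutely_integrable_imp_integrable) simp
  have ac: "abs_continuous_on {0..1} b"
  proof -
    have "abs_continuous_on {0..1} (\<lambda>t. D01 x t \<bullet> p t + - (x t \<bullet> (D01 p t + q t)))"
      using x p q unfolding AC1_def AC2_def
      by (intro abs_continuous_on_add abs_continuous_on_inner abs_continuous_on_minus[THEN iffD2]) auto
    then show ?thesis by (simp add: b_def)
  qed
  have sets: "{0..1::real} \<in> sets lebesgue" by simp
  have "AE t in lebesgue_on {0..1}. D01 x differentiable (at t within {0..1})
      \<and> D01 p differentiable (at t within {0..1}) \<and> q differentiable (at t within {0..1})"
    using x p q by (simp add: AC1_def AC2_def)
  then obtain N where N: "negligible N" and diff: "\<And>t. t \<in> {0..1} - N \<Longrightarrow>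
      D01 x differentiable (at t within {0..1}) \<and> D01 p differentiable (at t within {0..1})
      \<and> q differentiable (at t within {0..1})"
    unfolding AE_lebesgue_on_iff_negligible[OF sets] by blast
  have "(g has_integral b 1 - b 0) {0..1}"
  proof (rule abs_continuous_has_integral[OF _ ac N])
    fix t assume t: "t \<in> {0..1::real} - N"
    note D = diff[OF t, THEN conjunct1, THEN D01_works] diff[OF t, THEN conjunct2, THEN conjunct1, THEN D01_works]
      diff[OF t, THEN conjunct2, THEN conjunct2, THEN D01_works]
    have D1: "(x has_vector_derivative D01 x t) (at t within {0..1})"
      "(p has_vector_derivative D01 p t) (at t within {0..1})"
      using x p t by (auto simp: AC2_def intro: D01_works)
    note inner = bounded_bilinear.has_vector_derivative[OF bounded_bilinear_inner]
    have "(b has_vector_derivative (D01 x t \<bullet> D01 p t + D01 (D01 x) t \<bullet> p t)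
        - (x t \<bullet> (D01 (D01 p) t + D01 q t) + D01 x t \<bullet> (D01 p t + q t))) (at t within {0..1})"
      unfolding b_def by (intro has_vector_derivative_diff inner has_vector_derivative_add D D1)
    then show "(b has_vector_derivative g t) (at t within {0..1})"
      by (simp add: g_def algebra_simps inner_add_right)
  qed simp
  then show "integral\<^sup>L (lebesgue_on {0..1}) g = b 1 - b 0"
    using lebesgue_integral_eq_integral[OF int] by (simp add: integral_unique)
qed

section \<open>Weak duality and its equality case\<close>

text \<open>
  Four estimates are added: Fenchel's inequality, the bound of \<^const>\<open>M_fun\<close> integrated over time, and the
  two support functions at the initial data. Integration by parts makes the sum of their bounds equal to
  the primary objective.
\<close>

theorem duality_gap:
  fixes A B C :: "real^'n^'s"
  assumes x: "primal_feasible (poly_map A B C d) Q0 Q1 x" and l: "dual_feasible A B C l"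
  shows "dual_objective A B C d \<phi> Q0 Q1 l \<le> ereal (\<phi> (x 1, D01 x 1))"
    and "dual_objective A B C d \<phi> Q0 Q1 l = ereal (\<phi> (x 1, D01 x 1)) \<longleftrightarrow>
      (- D01 (tmul C l) 1 - tmul B l 1, tmul C l 1) \<in> subdifferential \<phi> (x 1, D01 x 1)
      \<and> (AE t in lebesgue_on {0..1}. (- tmul A l t, - tmul B l t)
            \<in> locally_adjoint (poly_map A B C d) (- tmul C l t) (x t, D01 x t, D01 (D01 x) t))
      \<and> - D01 (tmul C l) 0 - tmul B l 0 \<in> dual_tangent_cone Q0 (x 0)
      \<and> tmul C l 0 \<in> dual_tangent_cone Q1 (D01 x 0)" (is "_ \<longleftrightarrow> ?subdiff \<and> ?adj \<and> ?K0 \<and> ?K1")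
proof -
  let ?F = "poly_map A B C d" and ?\<mu> = "lebesgue_on {0..1::real}"
  define p q where "p = tmul C l" and "q = tmul B l"
  define M where "M t = M_fun ?F (- tmul A l t) (- q t) (- p t)" for t
  define g where "g = (\<lambda>t. D01 (D01 x) t \<bullet> p t - x t \<bullet> (D01 (D01 p) t + D01 q t) - D01 x t \<bullet> q t)"
  have reg: "AC2 x" "AC2 p" "AC1 q"
    and adjoint_eq: "AE t in ?\<mu>. tmul A l t = D01 (D01 p) t + D01 q t"
    and inclusion: "AE t in ?\<mu>. D01 (D01 x) t \<in> ?F (x t) (D01 x t)"
    and init: "x 0 \<in> Q0" "D01 x 0 \<in> Q1"
    using x l by (auto simp: primal_feasible_def dual_feasible_def regular_multiplier_iff p_def q_def
        elim: eventually_mono)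
  note parts = second_order_integration_by_parts[OF reg, folded g_def]
  have value_eq: "AE t in ?\<mu>. x t \<bullet> - tmul A l t + D01 x t \<bullet> - q t - D01 (D01 x) t \<bullet> - p t = g t"
    using adjoint_eq by eventually_elim (simp add: g_def inner_diff_right inner_add_right)
  have M_le: "AE t in ?\<mu>. M t \<le> ereal (g t)"
    using inclusion value_eq
  proof eventually_elim
    case (elim t)
    show ?case unfolding M_def elim(2)[symmetric] by (rule M_fun_le[of _ ?F, OF elim(1)])
  qed
  have adj_iff: "?adj \<longleftrightarrow> (AE t in ?\<mu>. M t = ereal (g t))"
  proof -
    have "AE t in ?\<mu>. M t = ereal (g t) \<longleftrightarrow> (- tmul A l t, - tmul B l t)
            \<in> locally_adjoint ?F (- tmul C l t) (x t, D01 x t, D01 (D01 x) t)"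
      using inclusion value_eq
    proof eventually_elim
      case (elim t)
      show ?case unfolding M_def elim(2)[symmetric] p_def q_def
        by (rule M_fun_eq_iff_locally_adjoint[of _ ?F, OF elim(1)])
    qed
    then show ?thesis by (auto elim: eventually_elim2)
  qed
  \<comment> \<open>a modification on a null set that is visibly measurable, by the adjoint equation\<close>
  define M' where "M' t = M_fun ?F (- (D01 (D01 p) t + D01 q t)) (- q t) (- p t)" for t
  have MM': "AE t in ?\<mu>. M t = M' t"
    using adjoint_eq by eventually_elim (simp add: M_def M'_def)
  have M': "M' \<in> borel_measurable ?\<mu>"
  proof -
    have "D01 (D01 p) \<in> borel_measurable ?\<mu>" "D01 q \<in> borel_measurable ?\<mu>"
      using reg by (auto simp: AC1_def AC2_def absolutely_integrable_measurable)
    moreover have "p \<in> borel_measurable ?\<mu>" "q \<in> borel_measurable ?\<mu>"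
      using AC2_continuous_on(1)[OF reg(2)] AC1_continuous_on[OF reg(3)]
      by (auto intro: continuous_imp_measurable_on_sets_lebesgue)
    ultimately show ?thesis
      unfolding M'_def by (intro borel_measurable_M_fun) auto
  qed
  have int_le: "ereal_integral ?\<mu> M \<le> ereal (integral\<^sup>L ?\<mu> g)"
    using ereal_integral_mono_AE[OF M_le] ereal_integral_real[OF parts(1)] by simp
  have int_eq: "ereal_integral ?\<mu> M = ereal (integral\<^sup>L ?\<mu> g) \<longleftrightarrow> ?adj"
  proof
    assume "ereal_integral ?\<mu> M = ereal (integral\<^sup>L ?\<mu> g)"
    then have eq: "ereal_integral ?\<mu> M' = ereal (integral\<^sup>L ?\<mu> g)"
      using ereal_integral_cong_AE[OF MM'] by simp
    have "AE t in ?\<mu>. M' t \<le> ereal (g t)" using M_le MM' by eventually_elim simp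
    from AE_eq_if_ereal_integral_eq[OF M' parts(1) this eq] MM'
    have "AE t in ?\<mu>. M t = ereal (g t)" by eventually_elim simp
    then show ?adj by (simp add: adj_iff)
  next
    assume ?adj
    then have "AE t in ?\<mu>. M t = ereal (g t)" by (simp add: adj_iff)
    from ereal_integral_cong_AE[OF this] ereal_integral_real[OF parts(1)]
    show "ereal_integral ?\<mu> M = ereal (integral\<^sup>L ?\<mu> g)" by simp
  qed
  let ?z = "(x 1, D01 x 1)" and ?r = "(- D01 p 1 - q 1, p 1)"
  have objective: "dual_objective A B C d \<phi> Q0 Q1 l = - conjugate \<phi> ?r + ereal_integral ?\<mu> M
      - support_fun Q0 (D01 p 0 + q 0) - support_fun Q1 (- p 0)"
    by (simp add: dual_objective_def M_def[abs_def] p_def q_def)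
  note bounds = conjugate_ge[of ?z ?r \<phi>] int_le support_fun_ge[OF init(1), of "D01 p 0 + q 0"]
    support_fun_ge[OF init(2), of "- p 0"]
  have telescope: "- (?z \<bullet> ?r - \<phi> ?z) + integral\<^sup>L ?\<mu> g - x 0 \<bullet> (D01 p 0 + q 0) - D01 x 0 \<bullet> (- p 0) = \<phi> ?z"
    unfolding parts(2) by (simp add: inner_diff_right inner_add_right)
  show "dual_objective A B C d \<phi> Q0 Q1 l \<le> ereal (\<phi> ?z)"
    using ereal_sum_of_bounds(1)[OF bounds] unfolding objective telescope .
  show "dual_objective A B C d \<phi> Q0 Q1 l = ereal (\<phi> ?z) \<longleftrightarrow> ?subdiff \<and> ?adj \<and> ?K0 \<and> ?K1"
    using ereal_sum_of_bounds(2)[OF bounds]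
    unfolding objective telescope int_eq conjugate_eq_iff_subdifferential
      support_fun_eq_iff_dual_tangent_cone[OF init(1)] support_fun_eq_iff_dual_tangent_cone[OF init(2)]
    by (simp add: p_def q_def)
qed

text \<open>
  The exchange of multipliers: where the normal vector of \<open>l t\<close> has a complementary multiplier, that one
  is chosen, and \<open>l t\<close> is kept elsewhere. The three products agree everywhere, hence also their
  regularity and derivatives.
\<close>

lemma exists_complementary_multiplier:
  fixes A B C :: "real^'n^'s"
  assumes nonneg: "\<forall>t\<in>{0..1}. 0 \<le> l t"
    and adj: "AE t in lebesgue_on {0..1}. (- tmul A l t, - tmul B l t)
            \<in> locally_adjoint (poly_map A B C d) (- tmul C l t) (x t, y t, z t)"
    and inclusion: "AE t in lebesgue_on {0..1}. z t \<in> poly_map A B C d (x t) (y t)"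
  obtains m where "\<forall>t\<in>{0..1}. 0 \<le> m t" "tmul A m = tmul A l" "tmul B m = tmul B l" "tmul C m = tmul C l"
    "AE t in lebesgue_on {0..1}. (A *v x t + B *v y t - C *v z t - d) \<bullet> m t = 0"
proof -
  define P where "P t u \<longleftrightarrow> 0 \<le> u \<and> transpose A *v u = tmul A l t \<and> transpose B *v u = tmul B l t
      \<and> transpose C *v u = tmul C l t \<and> (A *v x t + B *v y t - C *v z t - d) \<bullet> u = 0" for t u
  define m where "m t = (if Ex (P t) then Eps (P t) else l t)" for t
  have m: "P t (m t)" if "P t u" for t u
    using someI[of "P t" u] that by (auto simp: m_def)
  have m': "m t = l t" if "\<not> Ex (P t)" for t unfolding m_def by (rule if_not_P[OF that])
  have good: "AE t in lebesgue_on {0..1}. P t (m t)"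
    using adj inclusion
  proof eventually_elim
    case (elim t)
    then obtain u where "P t u"
      by (auto simp: locally_adjoint_poly_map_iff P_def tmul_def)
    then show ?case by (rule m)
  qed
  show thesis
  proof
    show "\<forall>t\<in>{0..1}. 0 \<le> m t"
      using nonneg m m' unfolding P_def by metis
    have "transpose A *v m t = tmul A l t \<and> transpose B *v m t = tmul B l t \<and> transpose C *v m t = tmul C l t" for t
      using m[of t] m'[of t] by (cases "Ex (P t)") (auto simp: P_def tmul_def)
    then show "tmul A m = tmul A l" "tmul B m = tmul B l" "tmul C m = tmul C l"
      by (auto simp: fun_eq_iff tmul_def)
    show "AE t in lebesgue_on {0..1}. (A *v x t + B *v y t - C *v z t - d) \<bullet> m t = 0"
      using good by eventually_elim (simp add: P_def)
  qed
qed

text \<open>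
  At almost every time a complementary multiplier exists by the description of the locally adjoint mapping.
  At the remaining times only the sign and the values of \<open>B\<^sup>*\<lambda>\<close> and \<open>C\<^sup>*\<lambda>\<close> are asked for. The pair
  of these values has to lie in a finitely generated cone, which is closed; by continuity the times
  at which it does form a closed set, and a closed set of full measure is the whole interval.
\<close>

lemma exists_adjoint_multiplier:
  fixes A B C :: "real^'n^'s"
  assumes cont: "continuous_on {0..1} w" "continuous_on {0..1} b"
    and adj: "AE t in lebesgue_on {0..1}. (a t, b t)
            \<in> locally_adjoint (poly_map A B C d) (w t) (x t, y t, z t)"
    and inclusion: "AE t in lebesgue_on {0..1}. z t \<in> poly_map A B C d (x t) (y t)"
  obtains l where "\<forall>t\<in>{0..1}. 0 \<le> l t"
    "\<And>t. t \<in> {0..1} \<Longrightarrow> tmul C l t = - w t" "\<And>t. t \<in> {0..1} \<Longrightarrow> tmul B l t = - b t"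
    "AE t in lebesgue_on {0..1}. tmul A l t = - a t \<and> (A *v x t + B *v y t - C *v z t - d) \<bullet> l t = 0"
proof -
  define h where "h u = (- (transpose B *v u), - (transpose C *v u))" for u :: "real^'s"
  define K where "K = h ` {u. 0 \<le> u}"
  have "linear h"
    by (rule linearI) (auto simp: h_def matrix_vector_right_distrib matrix_vector_mult_scaleR)
  from closed_linear_image_orthant_face[OF this, of UNIV] have "closed K" by (simp add: K_def)
  define P where "P t u \<longleftrightarrow> 0 \<le> u \<and> (b t, w t) = h u \<and> a t = - (transpose A *v u)
      \<and> (A *v x t + B *v y t - C *v z t - d) \<bullet> u = 0" for t u
  have good: "AE t in lebesgue_on {0..1}. \<exists>u. P t u"
    using adj inclusion
    by eventually_elim (auto simp: locally_adjoint_poly_map_iff P_def h_def)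
  have mem: "(b t, w t) \<in> K" if "t \<in> {0..1}" for t
  proof -
    define G where "G = {t \<in> {0..1}. (b t, w t) \<in> K}"
    have "closed G"
      unfolding G_def using continuous_closed_preimage[OF _ _ \<open>closed K\<close>, of "{0..1}" "\<lambda>t. (b t, w t)"] cont
      by (auto simp: vimage_def Int_def intro!: continuous_intros)
    have "AE t in lebesgue_on {0..1}. t \<in> G"
      using good AE_space by eventually_elim (auto simp: G_def P_def K_def)
    then have "AE t in lebesgue. t \<in> {0..1} \<longrightarrow> t \<in> G"
      by (simp add: AE_restrict_space_iff)
    then have "AE t \<in> {0<..<1} in lebesgue. t \<in> G" by eventually_elim auto
    from mem_closed_if_AE_lebesgue_open[OF open_greaterThanLessThan \<open>closed G\<close> this]
    have "{0<..<1} \<subseteq> G" by blast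
    then have "closure {0<..<1} \<subseteq> G" using \<open>closed G\<close> by (rule closure_minimal)
    with that show ?thesis by (auto simp: G_def)
  qed
  have "\<exists>u. t \<in> {0..1} \<longrightarrow> 0 \<le> u \<and> (b t, w t) = h u \<and> (Ex (P t) \<longrightarrow> P t u)" for t
  proof (cases "Ex (P t)")
    case True
    then show ?thesis by (auto simp: P_def)
  next
    case False
    then show ?thesis using mem[of t] by (auto simp: K_def)
  qed
  then obtain l where l: "\<And>t. t \<in> {0..1} \<Longrightarrow> 0 \<le> l t \<and> (b t, w t) = h (l t) \<and> (Ex (P t) \<longrightarrow> P t (l t))"
    by metis
  show thesis
  proof
    show "\<forall>t\<in>{0..1}. 0 \<le> l t" using l by blast
    show "tmul C l t = - w t" "tmul B l t = - b t" if "t \<in> {0..1}" for t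
      using l[OF that] by (auto simp: h_def tmul_def)
    show "AE t in lebesgue_on {0..1}. tmul A l t = - a t \<and> (A *v x t + B *v y t - C *v z t - d) \<bullet> l t = 0"
      using good AE_space
    proof eventually_elim
      case (elim t)
      then have "P t (l t)" using l[of t] by simp
      then show ?case by (simp add: P_def tmul_def)
    qed
  qed
qed

section \<open>The duality theorem\<close>

theorem theorem5p2:
  fixes A B C :: "real^'n^'s" and d :: "real^'s"
    and \<phi> :: "(real^'n) \<times> (real^'n) \<Rightarrow> real"
    and Q0 Q1 :: "(real^'n) set"
    and F :: "real^'n \<Rightarrow> real^'n \<Rightarrow> (real^'n) set"
    and x xs \<eta> :: "real \<Rightarrow> real^'n"
  defines "F \<equiv> poly_map A B C d"
  assumes \<phi>_cont: "continuous_on UNIV \<phi>" and \<phi>_convex: "convex_on UNIV \<phi>"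
    and Q0: "Q0 \<noteq> {}" "convex Q0" and Q1: "Q1 \<noteq> {}" "convex Q1"
    and optimal: "primal_optimal F \<phi> Q0 Q1 x"
    and xs_regular: "AC2 xs" and \<eta>_regular: "AC1 \<eta>"
    and cond_i: "AE t in lebesgue_on {0..1}.
      (D01 (D01 xs) t + D01 \<eta> t, \<eta> t) \<in> locally_adjoint F (xs t) (x t, D01 x t, D01 (D01 x) t)"
    and cond_ii: "D01 xs 0 + \<eta> 0 \<in> dual_tangent_cone Q0 (x 0)"
      "- xs 0 \<in> dual_tangent_cone Q1 (D01 x 0)"
    and cond_iii: "(D01 xs 1 + \<eta> 1, - xs 1) \<in> subdifferential \<phi> (x 1, D01 x 1)"
    and cond_iv: "AE t in lebesgue_on {0..1}.
      D01 (D01 x) t \<in> argmax_set F (x t) (D01 x t) (xs t)"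
  shows "(\<forall>zs :: real \<Rightarrow> real^'n.
      dual_optimal A B C d \<phi> Q0 Q1 zs \<longleftrightarrow>
      (\<exists>l :: real \<Rightarrow> real^'s.
          regular_multiplier B C l
        \<and> (\<forall>t\<in>{0..1}. 0 \<le> l t)
        \<and> (\<forall>t\<in>{0..1}. zs t = - tmul C l t)
        \<and> (AE t in lebesgue_on {0..1}.
              D01 (D01 (tmul C l)) t + D01 (tmul B l) t - tmul A l t = 0
            \<and> (A *v x t + B *v D01 x t - C *v D01 (D01 x) t - d) \<bullet> l t = 0)
        \<and> - D01 (tmul C l) 0 - tmul B l 0 \<in> dual_tangent_cone Q0 (x 0)
        \<and> tmul C l 0 \<in> dual_tangent_cone Q1 (D01 x 0)
        \<and> (- D01 (tmul C l) 1 - tmul B l 1, tmul C l 1) \<in> subdifferential \<phi> (x 1, D01 x 1)))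
    \<and> primal_value F \<phi> Q0 Q1 = dual_value A B C d \<phi> Q0 Q1"
proof -
  have feasible: "primal_feasible (poly_map A B C d) Q0 Q1 x"
    using optimal by (simp add: primal_optimal_def F_def)
  then have inclusion: "AE t in lebesgue_on {0..1}. D01 (D01 x) t \<in> poly_map A B C d (x t) (D01 x t)"
    by (simp add: primal_feasible_def)
  define v where "v = ereal (\<phi> (x 1, D01 x 1))"
  define obj where "obj = dual_objective A B C d \<phi> Q0 Q1"
  \<comment> \<open>the certificate of optimality: feasibility, complementary slackness and end point conditions\<close>
  define cert where "cert l \<longleftrightarrow> regular_multiplier B C l \<and> (\<forall>t\<in>{0..1}. 0 \<le> l t)
      \<and> (AE t in lebesgue_on {0..1}.
              D01 (D01 (tmul C l)) t + D01 (tmul B l) t - tmul A l t = 0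
            \<and> (A *v x t + B *v D01 x t - C *v D01 (D01 x) t - d) \<bullet> l t = 0)
      \<and> - D01 (tmul C l) 0 - tmul B l 0 \<in> dual_tangent_cone Q0 (x 0)
      \<and> tmul C l 0 \<in> dual_tangent_cone Q1 (D01 x 0)
      \<and> (- D01 (tmul C l) 1 - tmul B l 1, tmul C l 1) \<in> subdifferential \<phi> (x 1, D01 x 1)" for l
  note gap = duality_gap[OF feasible, where \<phi> = \<phi>, folded obj_def v_def]

  have certD: "dual_feasible A B C l \<and> obj l = v" if "cert l" for l
  proof -
    have l: "dual_feasible A B C l"
      using that by (auto simp: cert_def dual_feasible_def elim: eventually_mono)
    have "AE t in lebesgue_on {0..1}. t \<in> {0..1::real}" by (rule AE_I2) simp
    moreover have "AE t in lebesgue_on {0..1}. (A *v x t + B *v D01 x t - C *v D01 (D01 x) t - d) \<bullet> l t = 0"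
      using that by (auto simp: cert_def elim: eventually_mono)
    ultimately have "AE t in lebesgue_on {0..1}. (- tmul A l t, - tmul B l t)
            \<in> locally_adjoint (poly_map A B C d) (- tmul C l t) (x t, D01 x t, D01 (D01 x) t)"
      using inclusion
    proof eventually_elim
      case (elim t)
      have "0 \<le> l t" using that elim(1) by (simp add: cert_def)
      with elim show ?case
        by (auto simp: locally_adjoint_poly_map_iff tmul_def intro!: exI[of _ "l t"])
    qed
    with that l show ?thesis by (simp add: gap(2)[OF l] cert_def)
  qed

  \<comment> \<open>\<open>l\<close> itself may violate complementary slackness, so another multiplier with the same \<open>C\<^sup>*\<lambda>\<close> is returned\<close>
  have certI: "\<exists>m. cert m \<and> tmul C m = tmul C l" if l: "dual_feasible A B C l" and eq: "obj l = v" for l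
  proof -
    note opt = eq[unfolded gap(2)[OF l]]
    obtain m where m: "\<forall>t\<in>{0..1}. 0 \<le> m t" "tmul A m = tmul A l" "tmul B m = tmul B l" "tmul C m = tmul C l"
      "AE t in lebesgue_on {0..1}. (A *v x t + B *v D01 x t - C *v D01 (D01 x) t - d) \<bullet> m t = 0"
      using exists_complementary_multiplier[OF _ _ inclusion, of l] l opt by (auto simp: dual_feasible_def)
    have "cert m"
      using m l opt by (simp add: cert_def dual_feasible_def regular_multiplier_def)
    with m(4) show ?thesis by blast
  qed

  \<comment> \<open>strong duality: the sufficient conditions for \<open>x\<close> supply one certificate\<close>
  obtain l0 where l0: "cert l0"
  proof -
    obtain l where l: "\<forall>t\<in>{0..1}. 0 \<le> l t"
      and C: "\<And>t. t \<in> {0..1} \<Longrightarrow> tmul C l t = - xs t" and B: "\<And>t. t \<in> {0..1} \<Longrightarrow> tmul B l t = - \<eta> t"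
      and A: "AE t in lebesgue_on {0..1}. tmul A l t = - (D01 (D01 xs) t + D01 \<eta> t)
          \<and> (A *v x t + B *v D01 x t - C *v D01 (D01 x) t - d) \<bullet> l t = 0"
      using exists_adjoint_multiplier[OF AC2_continuous_on(1)[OF xs_regular] AC1_continuous_on[OF \<eta>_regular]
          cond_i[unfolded F_def] inclusion] by blast
    have "AC2 (\<lambda>t. - tmul C l t) \<longleftrightarrow> AC2 xs" "AC1 (\<lambda>t. - tmul B l t) \<longleftrightarrow> AC1 \<eta>"
      by (intro AC2_cong AC1_cong; simp add: B C)+
    then have reg: "regular_multiplier B C l"
      using xs_regular \<eta>_regular by (simp add: regular_multiplier_def)
    have DC: "D01 (tmul C l) t = - D01 xs t" if "t \<in> {0..1}" for t
      using D01_cong[of "tmul C l" "\<lambda>t. - xs t" t] D01_minus[of t xs] C that xs_regular by (simp add: AC2_def)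
    have DDC: "D01 (D01 (tmul C l)) t = D01 (D01 (\<lambda>t. - xs t)) t" if "t \<in> {0..1}" for t
      using that C by (intro D01_cong) auto
    have DB: "D01 (tmul B l) t = D01 (\<lambda>t. - \<eta> t) t" if "t \<in> {0..1}" for t
      using that B by (intro D01_cong) auto
    have diff: "AE t in lebesgue_on {0..1}. \<eta> differentiable (at t within {0..1})"
      using \<eta>_regular by (simp add: AC1_def)
    have "AE t in lebesgue_on {0..1}. t \<in> {0..1::real}" by (rule AE_I2) simp
    then have "AE t in lebesgue_on {0..1}. D01 (D01 (tmul C l)) t + D01 (tmul B l) t - tmul A l t = 0
        \<and> (A *v x t + B *v D01 x t - C *v D01 (D01 x) t - d) \<bullet> l t = 0"
      using diff A D01_D01_minus[OF xs_regular]
    proof eventually_elim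
      case (elim t)
      then show ?case
        by (simp only: DDC[OF elim(1)] DB[OF elim(1)] D01_minus[OF elim(1,2)]) simp
    qed
    then have "cert l"
      using l reg cond_ii cond_iii by (simp add: cert_def B C DC)
    then show thesis by (rule that)
  qed
  have max: "dual_feasible A B C l \<Longrightarrow> obj l \<le> obj l0" for l
    using gap(1) certD[OF l0] by simp

  have "dual_optimal A B C d \<phi> Q0 Q1 zs \<longleftrightarrow> (\<exists>l. cert l \<and> (\<forall>t\<in>{0..1}. zs t = - tmul C l t))" for zs
  proof
    assume "dual_optimal A B C d \<phi> Q0 Q1 zs"
    then obtain l where l: "dual_feasible A B C l" "obj l0 \<le> obj l" "\<forall>t\<in>{0..1}. zs t = - tmul C l t"
      using certD[OF l0] by (auto simp: dual_optimal_def obj_def)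
    have "obj l = v" using max[OF l(1)] l(2) certD[OF l0] by simp
    from certI[OF l(1) this] l(3) show "\<exists>l. cert l \<and> (\<forall>t\<in>{0..1}. zs t = - tmul C l t)" by auto
  next
    assume "\<exists>l. cert l \<and> (\<forall>t\<in>{0..1}. zs t = - tmul C l t)"
    then obtain l where "cert l" "\<forall>t\<in>{0..1}. zs t = - tmul C l t" by blast
    then show "dual_optimal A B C d \<phi> Q0 Q1 zs"
      using certD gap(1) by (auto simp: dual_optimal_def obj_def[symmetric] intro!: exI[of _ l])
  qed
  moreover have "primal_value F \<phi> Q0 Q1 = v"
    using optimal unfolding primal_value_def v_def primal_optimal_def
    by (intro INF_eqI) auto
  moreover have "dual_value A B C d \<phi> Q0 Q1 = v"
    using certD[OF l0] gap(1) unfolding dual_value_def obj_def[symmetric]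
    by (intro SUP_eqI) auto
  ultimately show ?thesis
    unfolding cert_def by (simp add: conj_ac)
qed

end
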